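(* Let $S$ be a completely regular semigroup. The following conditions are equivalent. (1) $\ker\nu$ is cryptic; (2) $\ker\nu\subseteq\ker\mu$; (3) $\nu\cap\mathcal{H}=\nu\cap\mu$; (4) $\nu\cap\mathcal{H}$ is a congruence on $S$; (5) $\lambda\subseteq\mu$; (6) $\lambda_t=\varepsilon$; (7) there exists an idempotent separating orthodox congruence on $S$; (8) $\lambda\cap\Theta=\varepsilon$; (9) $\lambda$ is over groups.
   Context: A completely regular semigroup is a semigroup that is a union of its subgroups; for $a\in S$, $a^{-1}$ is the inverse of $a$ in the maximal subgroup containing $a$, and $a^0=aa^{-1}=a^{-1}a$. $E(S)$ is the set of idempotents of $S$, $\mathcal{H}$ is Green's relation, and $\varepsilon$ is the equality relation. A semigroup is cryptic if its Green's relation $\mathcal{H}$ is a congruence on it. A regular semigroup is orthodox if its idempotents form a subsemigroup. A Clifford semigroup is a completely regular semigroup whose idempotents are central (equivalently, a semilattice of groups). A congruence $\rho$ on $S$ is a Clifford (resp. orthodox) congruence if $S/\rho$ is Clifford (resp. orthodox). For a congruence $\rho$ on $S$: $\operatorname{tr}\rho=\rho|_{E(S)}$ and $\ker\rho=\{a\in S: a\,\rho\,e\text{ for some }e\in E(S)\}$; $\rho_t$ denotes the least congruence on $S$ with the same trace as $\rho$. $\nu$ is the least Clifford congruence on $S$ and $\lambda$ is the least orthodox congruence on $S$ ($\lambda$ is also the least congruence on $S$ with the same kernel as $\nu$). The set $\ker\nu$ is a completely regular subsemigroup of $S$, and "$\ker\nu$ is cryptic" refers to Green's relation $\mathcal H$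 of the semigroup $\ker\nu$. A congruence is idempotent separating if any two idempotents related by it are equal; $\mu$ is the greatest idempotent separating congruence on $S$. The relation $\Theta$ on $S$ is defined by $a\,\Theta\,b\iff a^0b=ab^0$. A congruence is over groups if each of its classes that is a subsemigroup of $S$ is a group. *)

theory Defs
  imports "HOL-Algebra.Group"
begin

text \<open>
  A semigroup is given by a carrier set and a binary operation on the ambient type, so that
  subsemigroups (same operation) and quotients (carrier \<open>S // r\<close>) are instances of the same
  notions. All predicates below only depend on the operation on the carrier.
\<close>

context
  fixes S :: "'a set" and times :: "'a \<Rightarrow> 'a \<Rightarrow> 'a" (infixl "\<cdot>" 70)
begin

definition is_semigroup :: bool where
  "is_semigroup \<longleftrightarrow>
     (\<forall>a\<in>S. \<forall>b\<in>S. a \<cdot> b \<in> S) \<and>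
     (\<forall>a\<in>S. \<forall>b\<in>S. \<forall>c\<in>S. (a \<cdot> b) \<cdot> c = a \<cdot> (b \<cdot> c))"

definition idempotents :: "'a set" where
  "idempotents = {e \<in> S. e \<cdot> e = e}"

definition is_regular :: bool where
  "is_regular \<longleftrightarrow> is_semigroup \<and> (\<forall>a\<in>S. \<exists>x\<in>S. a \<cdot> x \<cdot> a = a)"

definition is_orthodox :: bool where
  "is_orthodox \<longleftrightarrow>
     is_regular \<and> (\<forall>e\<in>idempotents. \<forall>f\<in>idempotents. e \<cdot> f \<in> idempotents)"

text \<open>
  A group inside a semigroup has its own identity element, which is determined by the carrier
  and the operation. It is turned into a monoid record in order to use the library's groups.
\<close>

definition as_group :: "'a set \<Rightarrow> 'a monoid" where
  "as_group G =
     \<lparr>carrier = G, monoid.mult = (\<cdot>), one = (THE e. e \<in> G \<and> (\<forall>x\<in>G. e \<cdot> x = x \<and> x \<cdot> e = x))\<rparr>"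

definition is_subgroup :: "'a set \<Rightarrow> bool" where
  "is_subgroup G \<longleftrightarrow> G \<subseteq> S \<and> group (as_group G)"

definition completely_regular :: bool where
  "completely_regular \<longleftrightarrow> is_semigroup \<and> S = \<Union>{G. is_subgroup G}"

definition max_subgroup :: "'a \<Rightarrow> 'a set" where
  "max_subgroup a =
     (THE G. a \<in> G \<and> is_subgroup G \<and> (\<forall>K. is_subgroup K \<and> G \<subseteq> K \<longrightarrow> K = G))"

definition cr_inverse :: "'a \<Rightarrow> 'a" where
  "cr_inverse a = inv\<^bsub>as_group (max_subgroup a)\<^esub> a"

text \<open>The idempotent \<open>a\<^sup>0 = a a\<^sup>-\<^sup>1\<close>.\<close>

definition cr_zero :: "'a \<Rightarrow> 'a" where
  "cr_zero a = a \<cdot> cr_inverse a"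

definition is_clifford :: bool where
  "is_clifford \<longleftrightarrow> completely_regular \<and> (\<forall>e\<in>idempotents. \<forall>a\<in>S. e \<cdot> a = a \<cdot> e)"

text \<open>Green's relations, via the principal ideals \<open>S\<^sup>1 a\<close> and \<open>a S\<^sup>1\<close>.\<close>

definition green_L :: "'a rel" where
  "green_L = {(a, b) \<in> S \<times> S. insert a {s \<cdot> a | s. s \<in> S} = insert b {s \<cdot> b | s. s \<in> S}}"

definition green_R :: "'a rel" where
  "green_R = {(a, b) \<in> S \<times> S. insert a {a \<cdot> s | s. s \<in> S} = insert b {b \<cdot> s | s. s \<in> S}}"

definition green_H :: "'a rel" where
  "green_H = green_L \<inter> green_R"

definition is_congruence :: "'a rel \<Rightarrow> bool" where
  "is_congruence r \<longleftrightarrow>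
     equiv S r \<and> (\<forall>(a, b)\<in>r. \<forall>(c, d)\<in>r. (a \<cdot> c, b \<cdot> d) \<in> r)"

definition is_cryptic :: bool where
  "is_cryptic \<longleftrightarrow> is_semigroup \<and> is_congruence green_H"

definition quotient_times :: "'a rel \<Rightarrow> 'a set \<Rightarrow> 'a set \<Rightarrow> 'a set" where
  "quotient_times r A B = (\<Union>a\<in>A. \<Union>b\<in>B. r `` {a \<cdot> b})"

definition cong_trace :: "'a rel \<Rightarrow> 'a rel" where
  "cong_trace r = r \<inter> (idempotents \<times> idempotents)"

definition cong_kernel :: "'a rel \<Rightarrow> 'a set" where
  "cong_kernel r = {a \<in> S. \<exists>e\<in>idempotents. (a, e) \<in> r}"

definition idempotent_separating :: "'a rel \<Rightarrow> bool" where
  "idempotent_separating r \<longleftrightarrow>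
     (\<forall>e\<in>idempotents. \<forall>f\<in>idempotents. (e, f) \<in> r \<longrightarrow> e = f)"

definition over_groups :: "'a rel \<Rightarrow> bool" where
  "over_groups r \<longleftrightarrow>
     (\<forall>A\<in>S // r. (\<forall>a\<in>A. \<forall>b\<in>A. a \<cdot> b \<in> A) \<longrightarrow> is_subgroup A)"

definition least_same_trace :: "'a rel \<Rightarrow> 'a rel" where
  "least_same_trace r = (LEAST t. is_congruence t \<and> cong_trace t = cong_trace r)"

definition Theta :: "'a rel" where
  "Theta = {(a, b) \<in> S \<times> S. cr_zero a \<cdot> b = a \<cdot> cr_zero b}"

end

definition clifford_congruence :: "'a set \<Rightarrow> ('a \<Rightarrow> 'a \<Rightarrow> 'a) \<Rightarrow> 'a rel \<Rightarrow> bool" where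
  "clifford_congruence S f r \<longleftrightarrow>
     is_congruence S f r \<and> is_clifford (S // r) (quotient_times f r)"

definition orthodox_congruence :: "'a set \<Rightarrow> ('a \<Rightarrow> 'a \<Rightarrow> 'a) \<Rightarrow> 'a rel \<Rightarrow> bool" where
  "orthodox_congruence S f r \<longleftrightarrow>
     is_congruence S f r \<and> is_orthodox (S // r) (quotient_times f r)"

definition nu :: "'a set \<Rightarrow> ('a \<Rightarrow> 'a \<Rightarrow> 'a) \<Rightarrow> 'a rel" where
  "nu S f = (LEAST r. clifford_congruence S f r)"

definition lam :: "'a set \<Rightarrow> ('a \<Rightarrow> 'a \<Rightarrow> 'a) \<Rightarrow> 'a rel" where
  "lam S f = (LEAST r. orthodox_congruence S f r)"

definition mu :: "'a set \<Rightarrow> ('a \<Rightarrow> 'a \<Rightarrow> 'a) \<Rightarrow> 'a rel" where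
  "mu S f = (GREATEST r. is_congruence S f r \<and> idempotent_separating S f r)"

end

theory Submission
  imports Defs
begin

text \<open>
  In a completely regular semigroup \<open>a \<H> b\<close> means \<open>a\<^sup>0 = b\<^sup>0\<close>, so a congruence is idempotent
  separating iff it is contained in \<open>\<H>\<close>, and \<open>\<mu>\<close> is the largest congruence inside \<open>\<H>\<close>. Conditions
  (5)--(9) all say that \<open>\<lambda>\<close> is idempotent separating. For (1)--(4) the essential step is (1) to (2):
  \<open>x a\<close> is \<open>\<L>\<close>-related to \<open>x\<^sup>0 a\<close>, and \<open>x\<^sup>0\<close> lies in \<open>ker \<nu>\<close>, so compatibility of \<open>\<H>\<close> with
  multiplication inside \<open>ker \<nu>\<close> gives compatibility with translations by all of \<open>S\<close>.
  Both groups of conditions are linked by \<open>ker \<nu> \<subseteq> ker \<lambda>\<close>: on the orthodox semigroup \<open>S/\<lambda>\<close> the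
  relation ``same set of inverses'' is a congruence making idempotents commute, and only
  idempotents are related to idempotents.
\<close>

section \<open>Subgroups and inverses in completely regular semigroups\<close>

text \<open>Translates a group record into equations for \<open>f\<close>. The library's
  \<open>inv\<close> is kept in the conclusion because \<open>cr_inverse\<close> is defined by
  it.\<close>

lemma group_as_groupD:
  assumes "group (as_group f G)"
  obtains e where "e \<in> G" "\<And>x. x \<in> G \<Longrightarrow> f e x = x" "\<And>x. x \<in> G \<Longrightarrow> f x e = x"
    "\<And>x. x \<in> G \<Longrightarrow> inv\<^bsub>as_group f G\<^esub> x \<in> G \<and> f x (inv\<^bsub>as_group f G\<^esub> x) = e \<and> f (inv\<^bsub>as_group f G\<^esub> x) x = e"
proof -
  interpret group "as_group f G" by fact
  have [simp]: "carrier (as_group f G) = G" "monoid.mult (as_group f G) = f"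
    by (simp_all add: as_group_def)
  show thesis
  proof (rule that)
    show "\<one>\<^bsub>as_group f G\<^esub> \<in> G" using one_closed by simp
    show "f \<one>\<^bsub>as_group f G\<^esub> x = x" if "x \<in> G" for x using l_one[of x] that by simp
    show "f x \<one>\<^bsub>as_group f G\<^esub> = x" if "x \<in> G" for x using r_one[of x] that by simp
    show "inv\<^bsub>as_group f G\<^esub> x \<in> G \<and> f x (inv\<^bsub>as_group f G\<^esub> x) = \<one>\<^bsub>as_group f G\<^esub>
        \<and> f (inv\<^bsub>as_group f G\<^esub> x) x = \<one>\<^bsub>as_group f G\<^esub>" if "x \<in> G" for x
      using inv_closed[of x] r_inv[of x] l_inv[of x] that by simp
  qed
qed

text \<open>The field \<open>one\<close> is a definite description; a two-sided identity is unique,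
  so it evaluates to \<open>e\<close>, after which left inverses suffice.\<close>

lemma group_as_groupI:
  assumes "\<And>x y. x \<in> G \<Longrightarrow> y \<in> G \<Longrightarrow> f x y \<in> G"
    and "\<And>x y z. x \<in> G \<Longrightarrow> y \<in> G \<Longrightarrow> z \<in> G \<Longrightarrow> f (f x y) z = f x (f y z)"
    and "e \<in> G" "\<And>x. x \<in> G \<Longrightarrow> f e x = x" "\<And>x. x \<in> G \<Longrightarrow> f x e = x"
    and "\<And>x. x \<in> G \<Longrightarrow> \<exists>y\<in>G. f y x = e"
  shows "group (as_group f G)"
proof -
  have "(THE e. e \<in> G \<and> (\<forall>x\<in>G. f e x = x \<and> f x e = x)) = e"
    using assms(3-5) by (intro the_equality) force+
  then show ?thesis
    using assms by (intro groupI) (simp_all add: as_group_def)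
qed

section \<open>Maximal subgroups of a semigroup\<close>

locale semigroup_on =
  fixes S :: "'a set" and f :: "'a \<Rightarrow> 'a \<Rightarrow> 'a" (infixl "\<cdot>" 70)
  assumes semigroup: "is_semigroup S f"
begin

abbreviation E :: "'a set" where "E \<equiv> idempotents S f"

lemma closed [simp]: "a \<in> S \<Longrightarrow> b \<in> S \<Longrightarrow> a \<cdot> b \<in> S"
  using semigroup by (simp add: is_semigroup_def)

lemma assoc [simp]: "a \<in> S \<Longrightarrow> b \<in> S \<Longrightarrow> c \<in> S \<Longrightarrow> a \<cdot> b \<cdot> c = a \<cdot> (b \<cdot> c)"
  using semigroup by (simp add: is_semigroup_def)

lemma idem_iff: "e \<in> E \<longleftrightarrow> e \<in> S \<and> e \<cdot> e = e"
  by (simp add: idempotents_def)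

lemma idem [simp]: "e \<in> E \<Longrightarrow> e \<cdot> e = e" and idem_in [simp]: "e \<in> E \<Longrightarrow> e \<in> S"
  and idemI: "e \<in> S \<Longrightarrow> e \<cdot> e = e \<Longrightarrow> e \<in> E"
  unfolding idem_iff by blast+

lemma idem_left [simp]: "e \<in> E \<Longrightarrow> a \<in> S \<Longrightarrow> e \<cdot> (e \<cdot> a) = e \<cdot> a"
  using assoc[of e e a] by simp

text \<open>For idempotent \<open>e\<close> this is the group of units of the local monoid
  \<open>e S e\<close>, that is, the maximal subgroup with identity \<open>e\<close>.\<close>

definition units_at :: "'a \<Rightarrow> 'a set" where
  "units_at e = {b \<in> S. e \<cdot> b = b \<and> b \<cdot> e = b \<and>
     (\<exists>c\<in>S. e \<cdot> c = c \<and> c \<cdot> e = c \<and> b \<cdot> c = e \<and> c \<cdot> b = e)}"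

lemma subgroup_units_at:
  assumes "e \<in> E"
  shows "is_subgroup S f (units_at e)"
proof -
  have "group (as_group f (units_at e))"
  proof (rule group_as_groupI)
    show "e \<in> units_at e" using assms by (auto simp: units_at_def intro!: bexI[of _ e])
  next
    fix x y assume "x \<in> units_at e" "y \<in> units_at e"
    then obtain x' y' where x: "x \<in> S" "e \<cdot> x = x" "x \<cdot> e = x" "x' \<in> S" "e \<cdot> x' = x'" "x' \<cdot> e = x'"
        "x \<cdot> x' = e" "x' \<cdot> x = e"
      and y: "y \<in> S" "e \<cdot> y = y" "y \<cdot> e = y" "y' \<in> S" "e \<cdot> y' = y'" "y' \<cdot> e = y'"
        "y \<cdot> y' = e" "y' \<cdot> y = e"
      by (auto simp: units_at_def)
    note eS = idem_in[OF assms]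
    have "x \<cdot> y \<cdot> (y' \<cdot> x') = x \<cdot> (y \<cdot> y' \<cdot> x')" using x(1,4) y(1,4) by simp
    also have "\<dots> = e" using x y by simp
    finally have 1: "x \<cdot> y \<cdot> (y' \<cdot> x') = e" .
    have "y' \<cdot> x' \<cdot> (x \<cdot> y) = y' \<cdot> (x' \<cdot> x \<cdot> y)" using x(1,4) y(1,4) by simp
    also have "\<dots> = e" using x y by simp
    finally have 2: "y' \<cdot> x' \<cdot> (x \<cdot> y) = e" .
    have 3: "e \<cdot> (x \<cdot> y) = x \<cdot> y" "e \<cdot> (y' \<cdot> x') = y' \<cdot> x'"
      using x(1,2,4) y(1,4,5) eS by (metis assoc)+
    have 4: "x \<cdot> y \<cdot> e = x \<cdot> y" "y' \<cdot> x' \<cdot> e = y' \<cdot> x'"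
      using x(1,4,6) y(1,3,4) eS by simp_all
    show "x \<cdot> y \<in> units_at e"
      unfolding units_at_def using 1 2 3 4 closed x(1,4) y(1,4) by blast
  next
    fix x assume "x \<in> units_at e"
    then show "\<exists>y\<in>units_at e. y \<cdot> x = e" by (auto simp: units_at_def)
  next
    fix x y z assume "x \<in> units_at e" "y \<in> units_at e" "z \<in> units_at e"
    then have "x \<in> S" "y \<in> S" "z \<in> S" unfolding units_at_def by blast+
    then show "x \<cdot> y \<cdot> z = x \<cdot> (y \<cdot> z)" by (rule assoc)
  next
    fix x assume "x \<in> units_at e"
    then show "e \<cdot> x = x" "x \<cdot> e = x" unfolding units_at_def by blast+
  qed
  moreover have "units_at e \<subseteq> S" unfolding units_at_def by blast
  ultimately show ?thesis by (simp add: is_subgroup_def)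
qed

text \<open>Both elements equal \<open>e' e\<close>: writing \<open>e = a y\<close> gives
  \<open>e' e = e\<close>, and writing \<open>e' = y' a\<close> gives
  \<open>e' e = e'\<close>.\<close>

lemma idem_unique:
  assumes "a \<in> S" "e \<in> S" "e' \<in> S" "y \<in> S" "y' \<in> S"
    and "e \<cdot> a = a" "a \<cdot> e = a" "a \<cdot> y = e"
    and "e' \<cdot> a = a" "a \<cdot> e' = a" "y' \<cdot> a = e'"
  shows "e = e'"
proof -
  have "e' \<cdot> e = e" using assms by (metis assoc)
  moreover have "e' \<cdot> e = e'" using assms by (metis assoc)
  ultimately show ?thesis by simp
qed

text \<open>The identity of \<open>K\<close> coincides with \<open>e\<close> by
  \<open>idem_unique\<close>, so inverses in \<open>K\<close> are inverses with respect to
  \<open>e\<close>. Hence \<open>units_at e\<close> contains every subgroup that meets it, which is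
  more than maximality.\<close>

lemma subgroup_le_units_at:
  assumes "is_subgroup S f K" "a \<in> K" "a \<in> units_at e" "e \<in> E"
  shows "K \<subseteq> units_at e"
proof -
  have KS: "K \<subseteq> S" using assms(1) by (simp add: is_subgroup_def)
  have gr: "group (as_group f K)" using assms(1) by (simp add: is_subgroup_def)
  obtain e' where e': "e' \<in> K" "\<And>x. x \<in> K \<Longrightarrow> e' \<cdot> x = x" "\<And>x. x \<in> K \<Longrightarrow> x \<cdot> e' = x"
    and iv: "\<And>x. x \<in> K \<Longrightarrow> \<exists>y\<in>K. x \<cdot> y = e' \<and> y \<cdot> x = e'"
    using group_as_groupD[OF gr] by metis
  obtain y where y: "y \<in> S" "a \<cdot> y = e" and a: "a \<in> S" "e \<cdot> a = a" "a \<cdot> e = a"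
    using assms(3) by (auto simp: units_at_def)
  obtain y' where "y' \<in> K" "y' \<cdot> a = e'" using iv assms(2) by blast
  then have "e = e'"
    using idem_unique[of a e e' y y'] a y e' assms(2,4) KS by auto
  then show ?thesis unfolding units_at_def using e' iv KS by (intro subsetI CollectI) (meson subsetD)
qed

text \<open>A maximal subgroup containing \<open>a\<close> lies inside the subgroup
  \<open>units_at e\<close> and so equals it; this resolves the definite description in
  \<open>max_subgroup\<close>.\<close>

lemma max_subgroup_eq:
  assumes "e \<in> E" "a \<in> units_at e"
  shows "max_subgroup S f a = units_at e"
  unfolding max_subgroup_def
proof (rule the_equality)
  show "a \<in> units_at e \<and> is_subgroup S f (units_at e) \<and>
      (\<forall>K. is_subgroup S f K \<and> units_at e \<subseteq> K \<longrightarrow> K = units_at e)"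
    using assms subgroup_units_at[of e] subgroup_le_units_at[of _ a e] by blast
  fix G assume "a \<in> G \<and> is_subgroup S f G \<and> (\<forall>K. is_subgroup S f K \<and> G \<subseteq> K \<longrightarrow> K = G)"
  then show "G = units_at e"
    using assms subgroup_units_at subgroup_le_units_at by metis
qed

lemma units_atI:
  assumes "a \<in> S" "x \<in> S" "a \<cdot> x \<cdot> a = a" "a \<cdot> x = x \<cdot> a"
  shows "a \<cdot> x \<in> E" "a \<in> units_at (a \<cdot> x)"
proof -
  have ax: "a \<cdot> x \<in> S" using assms by simp
  have 1: "a \<cdot> x \<cdot> a = a" "a \<cdot> (a \<cdot> x) = a" using assms by (metis assoc)+
  have 2: "(a \<cdot> x) \<cdot> (a \<cdot> x) = a \<cdot> x"
    using assms(1-3) by (metis assoc closed)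
  then show E: "a \<cdot> x \<in> E" using ax by (simp add: idemI)
  \<comment> \<open>With \<open>e = a x\<close>, the element \<open>x\<close> itself may fail
    \<open>e x = x\<close>; \<open>?y = e x\<close> satisfies it and is still inverse to
    \<open>a\<close>.\<close>
  let ?y = "a \<cdot> x \<cdot> x"
  have 3: "a \<cdot> ?y = a \<cdot> x" using 1(2) assms(1,2) ax by (metis assoc)
  have "?y \<cdot> a = (a \<cdot> x) \<cdot> (x \<cdot> a)" using assms(1,2) by simp
  then have 4: "?y \<cdot> a = a \<cdot> x" using 2 assms(4) by simp
  have "(a \<cdot> x) \<cdot> ?y = ((a \<cdot> x) \<cdot> (a \<cdot> x)) \<cdot> x" using assms(1,2) by simp
  then have 5: "(a \<cdot> x) \<cdot> ?y = ?y" unfolding 2 .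
  have "?y \<cdot> (a \<cdot> x) = (a \<cdot> x) \<cdot> (x \<cdot> a) \<cdot> x" using assms(1,2) by simp
  then have 6: "?y \<cdot> (a \<cdot> x) = ?y" unfolding assms(4)[symmetric] 2 .
  have "?y \<in> S" using ax assms(2) by (rule closed)
  then show "a \<in> units_at (a \<cdot> x)"
    unfolding units_at_def using 1 3 4 5 6 assms(1) by blast
qed

text \<open>A single commuting \<open>x\<close> with \<open>a x a = a\<close> already places
  \<open>a\<close> in a subgroup. This criterion is easy to check in quotients and in subsemigroups
  closed under inverses.\<close>

lemma completely_regularI:
  assumes "\<And>a. a \<in> S \<Longrightarrow> \<exists>x\<in>S. a \<cdot> x \<cdot> a = a \<and> a \<cdot> x = x \<cdot> a"
  shows "completely_regular S f"
proof -
  have "\<exists>G. is_subgroup S f G \<and> a \<in> G" if "a \<in> S" for a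
    using assms[OF that] that units_atI subgroup_units_at by metis
  then show ?thesis
    unfolding completely_regular_def using semigroup by (auto simp: is_subgroup_def)
qed

end

section \<open>Inverses and the idempotents \<open>a\<^sup>0\<close> in completely regular
  semigroups\<close>

locale cr_semigroup =
  fixes S :: "'a set" and f :: "'a \<Rightarrow> 'a \<Rightarrow> 'a" (infixl "\<cdot>" 70)
  assumes cr: "completely_regular S f"

sublocale cr_semigroup \<subseteq> semigroup_on
  using cr by unfold_locales (simp add: completely_regular_def)

context cr_semigroup
begin

abbreviation inverse_of :: "'a \<Rightarrow> 'a" (\<open>\<iota>\<close>) where "\<iota> \<equiv> cr_inverse S f"
abbreviation zero_of :: "'a \<Rightarrow> 'a" (\<open>_\<^sup>0\<close> [1000] 999) where "a\<^sup>0 \<equiv> cr_zero S f a"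

text \<open>Some subgroup around \<open>a\<close> supplies an identity and an inverse for
  \<open>a\<close>; hence \<open>a\<close> lies in some \<open>units_at e\<close>, which is the
  maximal subgroup used by \<open>cr_inverse\<close>.\<close>

lemma inverse_props:
  assumes "a \<in> S"
  shows "\<iota> a \<in> S" "\<iota> a \<cdot> a = a\<^sup>0" "a\<^sup>0 \<in> E" "a\<^sup>0 \<cdot> a = a" "a \<cdot> a\<^sup>0 = a"
    "a\<^sup>0 \<cdot> \<iota> a = \<iota> a" "\<iota> a \<cdot> a\<^sup>0 = \<iota> a"
proof -
  obtain K where K: "is_subgroup S f K" "a \<in> K"
    using cr assms by (auto simp: completely_regular_def)
  have "group (as_group f K)" "K \<subseteq> S" using K by (auto simp: is_subgroup_def)
  then obtain e y where "e \<in> S" "e \<cdot> a = a" "a \<cdot> e = a" "y \<in> S" "a \<cdot> y = e" "y \<cdot> a = e"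
    using K(2) by (elim group_as_groupD) (metis subsetD)
  then obtain e where e: "e \<in> E" "a \<in> units_at e"
    using units_atI assms by metis
  have m: "max_subgroup S f a = units_at e" using max_subgroup_eq e by blast
  have "group (as_group f (units_at e))"
    using subgroup_units_at[OF e(1)] by (simp add: is_subgroup_def)
  then obtain e' where e': "e' \<in> units_at e" "\<And>x. x \<in> units_at e \<Longrightarrow> e' \<cdot> x = x"
      "\<And>x. x \<in> units_at e \<Longrightarrow> x \<cdot> e' = x"
    and iv: "\<iota> a \<in> units_at e" "a \<cdot> \<iota> a = e'" "\<iota> a \<cdot> a = e'"
    using e(2) unfolding cr_inverse_def m by (elim group_as_groupD) blast
  have z: "a\<^sup>0 = e'" using iv by (simp add: cr_zero_def)
  have US: "units_at e \<subseteq> S" by (auto simp: units_at_def)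
  have e'S: "e' \<in> S" using e'(1) US by blast
  show "\<iota> a \<in> S" using iv(1) US by blast
  show "\<iota> a \<cdot> a = a\<^sup>0" using iv(3) unfolding z .
  have "e' \<cdot> e' = e'" by (rule e'(2)[OF e'(1)])
  then show "a\<^sup>0 \<in> E" unfolding z by (rule idemI[OF e'S])
  show "a\<^sup>0 \<cdot> a = a" unfolding z by (rule e'(2)[OF e(2)])
  show "a \<cdot> a\<^sup>0 = a" unfolding z by (rule e'(3)[OF e(2)])
  show "a\<^sup>0 \<cdot> \<iota> a = \<iota> a" unfolding z by (rule e'(2)[OF iv(1)])
  show "\<iota> a \<cdot> a\<^sup>0 = \<iota> a" unfolding z by (rule e'(3)[OF iv(1)])
qed

lemmas inverse_in [simp] = inverse_props(1)
lemmas inverse_left [simp] = inverse_props(2)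
lemmas zero_idem [simp] = inverse_props(3)
lemmas zero_left [simp] = inverse_props(4)
lemmas zero_right [simp] = inverse_props(5)
lemmas zero_inverse [simp] = inverse_props(6)
lemmas inverse_zero [simp] = inverse_props(7)

lemma inverse_right [simp]: "a \<cdot> \<iota> a = a\<^sup>0"
  by (simp add: cr_zero_def)

lemma zero_in [simp]: "a \<in> S \<Longrightarrow> a\<^sup>0 \<in> S"
  by (rule idem_in[OF zero_idem])

lemma product_left: "u \<in> S \<Longrightarrow> v \<in> S \<Longrightarrow> b \<in> S \<Longrightarrow> u \<cdot> v = w \<Longrightarrow> u \<cdot> (v \<cdot> b) = w \<cdot> b"
  using assoc[of u v b] by simp

lemma cancel_left [simp]:
  assumes "a \<in> S" "b \<in> S"
  shows "\<iota> a \<cdot> (a \<cdot> b) = a\<^sup>0 \<cdot> b" "a \<cdot> (\<iota> a \<cdot> b) = a\<^sup>0 \<cdot> b" "a\<^sup>0 \<cdot> (a \<cdot> b) = a \<cdot> b"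
    "a \<cdot> (a\<^sup>0 \<cdot> b) = a \<cdot> b" "a\<^sup>0 \<cdot> (\<iota> a \<cdot> b) = \<iota> a \<cdot> b" "\<iota> a \<cdot> (a\<^sup>0 \<cdot> b) = \<iota> a \<cdot> b"
  using assms by (auto intro!: product_left simp del: assoc)

text \<open>By \<open>idem_unique\<close>, any commuting inverse yields the same idempotent. So
  \<open>a\<^sup>0\<close> can be computed in quotients and subsemigroups without looking at their
  maximal subgroups.\<close>

lemma zero_eqI:
  assumes "a \<in> S" "x \<in> S" "a \<cdot> x \<cdot> a = a" "a \<cdot> x = x \<cdot> a"
  shows "a\<^sup>0 = a \<cdot> x"
proof (rule idem_unique[of a "a\<^sup>0" "a \<cdot> x" "\<iota> a" x])
  show "a \<cdot> (a \<cdot> x) = a" "x \<cdot> a = a \<cdot> x" "a \<cdot> x \<cdot> a = a" using assms by (metis assoc)+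
  show "a \<cdot> x \<in> S" using assms(1,2) by (rule closed)
qed (use assms(1,2) in simp_all)

lemma zero_of_idem [simp]: "e \<in> E \<Longrightarrow> e\<^sup>0 = e"
  using zero_eqI[of e e] by simp

section \<open>Green's relations in a completely regular semigroup\<close>

lemma green_L_iff:
  "(a, b) \<in> green_L S f \<longleftrightarrow> a \<in> S \<and> b \<in> S \<and> (\<exists>s\<in>S. a = s \<cdot> b) \<and> (\<exists>s\<in>S. b = s \<cdot> a)"
proof -
  have ideal: "\<exists>s\<in>S. a = s \<cdot> b" if "insert a {s \<cdot> a |s. s \<in> S} = insert b {s \<cdot> b |s. s \<in> S}" "b \<in> S" for a b
  proof -
    have "a \<in> insert b {s \<cdot> b |s. s \<in> S}" using that(1) by (metis insertI1)
    \<comment> \<open>In the case \<open>a = b\<close> the left multiplier is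
      \<open>b\<^sup>0\<close>, as \<open>b\<^sup>0 b = b\<close>.\<close>
    then show ?thesis
      unfolding insert_iff mem_Collect_eq using that(2) by (metis zero_in zero_left zero_right)
  qed
  have sub: "insert a {s \<cdot> a |s. s \<in> S} \<subseteq> insert b {s \<cdot> b |s. s \<in> S}" if h: "t \<in> S" "a = t \<cdot> b" "b \<in> S" for a b t
  proof
    fix x assume "x \<in> insert a {s \<cdot> a |s. s \<in> S}"
    then consider "x = t \<cdot> b" | u where "u \<in> S" "x = u \<cdot> (t \<cdot> b)" using h(2) by blast
    then show "x \<in> insert b {s \<cdot> b |s. s \<in> S}"
    proof cases
      case 2
      then have "x = (u \<cdot> t) \<cdot> b" "u \<cdot> t \<in> S" using h(1,3) by simp_all
      then show ?thesis by blast
    qed (use h(1) in blast)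
  qed
  show ?thesis
  proof
    assume "(a, b) \<in> green_L S f"
    then have "a \<in> S" "b \<in> S" and eq: "insert a {s \<cdot> a |s. s \<in> S} = insert b {s \<cdot> b |s. s \<in> S}"
      unfolding green_L_def by blast+
    then show "a \<in> S \<and> b \<in> S \<and> (\<exists>s\<in>S. a = s \<cdot> b) \<and> (\<exists>s\<in>S. b = s \<cdot> a)"
      using ideal[OF eq] ideal[OF eq[symmetric]] by simp
  next
    assume rhs: "a \<in> S \<and> b \<in> S \<and> (\<exists>s\<in>S. a = s \<cdot> b) \<and> (\<exists>s\<in>S. b = s \<cdot> a)"
    then have "insert a {s \<cdot> a |s. s \<in> S} = insert b {s \<cdot> b |s. s \<in> S}"
      using sub[of _ a b] sub[of _ b a] by (intro subset_antisym) blast+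
    then show "(a, b) \<in> green_L S f" using rhs unfolding green_L_def by blast
  qed
qed

lemma green_R_iff:
  "(a, b) \<in> green_R S f \<longleftrightarrow> a \<in> S \<and> b \<in> S \<and> (\<exists>s\<in>S. a = b \<cdot> s) \<and> (\<exists>s\<in>S. b = a \<cdot> s)"
proof -
  have ideal: "\<exists>s\<in>S. a = b \<cdot> s" if "insert a {a \<cdot> s |s. s \<in> S} = insert b {b \<cdot> s |s. s \<in> S}" "b \<in> S" for a b
  proof -
    have "a \<in> insert b {b \<cdot> s |s. s \<in> S}" using that(1) by (metis insertI1)
    then show ?thesis
      unfolding insert_iff mem_Collect_eq using that(2) by (metis zero_in zero_left zero_right)
  qed
  have sub: "insert a {a \<cdot> s |s. s \<in> S} \<subseteq> insert b {b \<cdot> s |s. s \<in> S}" if h: "t \<in> S" "a = b \<cdot> t" "b \<in> S" for a b t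
  proof
    fix x assume "x \<in> insert a {a \<cdot> s |s. s \<in> S}"
    then consider "x = b \<cdot> t" | u where "u \<in> S" "x = b \<cdot> t \<cdot> u" using h(2) by blast
    then show "x \<in> insert b {b \<cdot> s |s. s \<in> S}"
    proof cases
      case 2
      then have "x = b \<cdot> (t \<cdot> u)" "t \<cdot> u \<in> S" using h(1,3) by simp_all
      then show ?thesis by blast
    qed (use h(1) in blast)
  qed
  show ?thesis
  proof
    assume "(a, b) \<in> green_R S f"
    then have "a \<in> S" "b \<in> S" and eq: "insert a {a \<cdot> s |s. s \<in> S} = insert b {b \<cdot> s |s. s \<in> S}"
      unfolding green_R_def by blast+
    then show "a \<in> S \<and> b \<in> S \<and> (\<exists>s\<in>S. a = b \<cdot> s) \<and> (\<exists>s\<in>S. b = a \<cdot> s)"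
      using ideal[OF eq] ideal[OF eq[symmetric]] by simp
  next
    assume rhs: "a \<in> S \<and> b \<in> S \<and> (\<exists>s\<in>S. a = b \<cdot> s) \<and> (\<exists>s\<in>S. b = a \<cdot> s)"
    then have "insert a {a \<cdot> s |s. s \<in> S} = insert b {b \<cdot> s |s. s \<in> S}"
      using sub[of _ a b] sub[of _ b a] by (intro subset_antisym) blast+
    then show "(a, b) \<in> green_R S f" using rhs unfolding green_R_def by blast
  qed
qed

text \<open>If \<open>a\<close> is a left multiple of \<open>b\<close> then
  \<open>a b\<^sup>0 = a\<close>, and if \<open>b\<close> is a right multiple of \<open>a\<close>
  then \<open>a\<^sup>0 b = b\<close>; so \<open>a\<^sup>0 b\<^sup>0\<close> equals both
  \<open>a\<^sup>0\<close> and \<open>b\<^sup>0\<close>. Conversely, when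
  \<open>a\<^sup>0 = b\<^sup>0\<close>, the multipliers come from \<open>a = (a \<iota> b) b\<close>
  and its variants.\<close>

lemma green_H_iff: "(a, b) \<in> green_H S f \<longleftrightarrow> a \<in> S \<and> b \<in> S \<and> a\<^sup>0 = b\<^sup>0"
proof (intro iffI)
  assume "(a, b) \<in> green_H S f"
  then have S: "a \<in> S" "b \<in> S"
    and "\<exists>s\<in>S. a = s \<cdot> b" "\<exists>t\<in>S. b = a \<cdot> t" "\<exists>s\<in>S. a = b \<cdot> s" "\<exists>t\<in>S. b = t \<cdot> a"
    by (auto simp: green_H_def green_L_iff green_R_iff)
  then obtain s t u v where s: "s \<in> S" "a = s \<cdot> b" and t: "t \<in> S" "b = a \<cdot> t"
    and u: "u \<in> S" "a = b \<cdot> u" and v: "v \<in> S" "b = v \<cdot> a"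
    by blast
  have 1: "a \<cdot> b\<^sup>0 = a" using S s by (metis assoc zero_in zero_right)
  have 2: "a\<^sup>0 \<cdot> b = b" using S t by (metis assoc zero_in zero_left)
  have "a\<^sup>0 \<cdot> b\<^sup>0 = a\<^sup>0" using 1 S by (metis assoc inverse_in zero_in inverse_left)
  moreover have "a\<^sup>0 \<cdot> b\<^sup>0 = b\<^sup>0" using 2 S by (metis assoc inverse_in zero_in inverse_right)
  ultimately show "a \<in> S \<and> b \<in> S \<and> a\<^sup>0 = b\<^sup>0" using S by simp
next
  assume h: "a \<in> S \<and> b \<in> S \<and> a\<^sup>0 = b\<^sup>0"
  have "a \<in> S" "b \<in> S" and eq: "b\<^sup>0 = a\<^sup>0" using h by simp_all
  then have "a = (a \<cdot> \<iota> b) \<cdot> b" "b = (b \<cdot> \<iota> a) \<cdot> a" "a = b \<cdot> (\<iota> b \<cdot> a)" "b = a \<cdot> (\<iota> a \<cdot> b)"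
    using zero_left[of b] zero_right[of b] by (simp_all add: eq)
  moreover have "a \<cdot> \<iota> b \<in> S" "b \<cdot> \<iota> a \<in> S" "\<iota> b \<cdot> a \<in> S" "\<iota> a \<cdot> b \<in> S" using h by simp_all
  ultimately show "(a, b) \<in> green_H S f"
    using h unfolding green_H_def green_L_iff green_R_iff Int_iff by blast
qed

end

section \<open>Congruences and quotients\<close>

locale congruence_on = semigroup_on S f for S :: "'a set" and f (infixl "\<cdot>" 70) +
  fixes r :: "'a rel"
  assumes congruence: "is_congruence S f r"
begin

abbreviation cls :: "'a \<Rightarrow> 'a set" where "cls a \<equiv> r `` {a}"
abbreviation qmult :: "'a set \<Rightarrow> 'a set \<Rightarrow> 'a set" where "qmult \<equiv> quotient_times f r"

lemma equivalence: "equiv S r"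
  using congruence by (simp add: is_congruence_def)

lemma mult: "(a, b) \<in> r \<Longrightarrow> (c, d) \<in> r \<Longrightarrow> (a \<cdot> c, b \<cdot> d) \<in> r"
  using congruence unfolding is_congruence_def by blast

lemma refl: "a \<in> S \<Longrightarrow> (a, a) \<in> r"
  and sym: "(a, b) \<in> r \<Longrightarrow> (b, a) \<in> r"
  and trans [trans]: "(a, b) \<in> r \<Longrightarrow> (b, c) \<in> r \<Longrightarrow> (a, c) \<in> r"
  and in_carrier: "(a, b) \<in> r \<Longrightarrow> a \<in> S" "(a, b) \<in> r \<Longrightarrow> b \<in> S"
  using equivalence unfolding equiv_def refl_on_def by (blast dest: symD transD)+

lemma cls_eq_iff: "a \<in> S \<Longrightarrow> b \<in> S \<Longrightarrow> cls a = cls b \<longleftrightarrow> (a, b) \<in> r"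
  using eq_equiv_class_iff[OF equivalence] .

lemma cls_in: "a \<in> S \<Longrightarrow> cls a \<in> S // r"
  by (rule quotientI)

text \<open>By compatibility all classes in the union defining \<open>quotient_times\<close>
  coincide, so products may be computed on representatives.\<close>

lemma qmult_cls:
  assumes "a \<in> S" "b \<in> S"
  shows "qmult (cls a) (cls b) = cls (a \<cdot> b)"
proof -
  have "cls (x \<cdot> y) = cls (a \<cdot> b)" if "x \<in> cls a" "y \<in> cls b" for x y
  proof -
    have "(a \<cdot> b, x \<cdot> y) \<in> r" using that mult by blast
    then show ?thesis using equiv_class_eq[OF equivalence] by metis
  qed
  moreover have "a \<in> cls a" "b \<in> cls b" using refl assms by blast+
  ultimately show ?thesis unfolding quotient_times_def by blast
qed

lemma semigroup_quotient: "semigroup_on (S // r) qmult"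
proof
  have "qmult A B \<in> S // r" if "A \<in> S // r" "B \<in> S // r" for A B
    using that by (elim quotientE) (simp add: qmult_cls cls_in)
  moreover have "qmult (qmult A B) C = qmult A (qmult B C)"
    if "A \<in> S // r" "B \<in> S // r" "C \<in> S // r" for A B C
    using that by (elim quotientE) (simp add: qmult_cls)
  ultimately show "is_semigroup (S // r) qmult" by (simp add: is_semigroup_def)
qed

lemma cls_idem_iff: "a \<in> S \<Longrightarrow> cls a \<in> idempotents (S // r) qmult \<longleftrightarrow> (a \<cdot> a, a) \<in> r"
  unfolding semigroup_on.idem_iff[OF semigroup_quotient] using cls_in by (simp add: qmult_cls cls_eq_iff)

end

section \<open>Intersections of congruences and generated congruences\<close>

context semigroup_on
begin

lemma is_congruenceI:
  assumes "equiv S r"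
    and left: "\<And>a b c. c \<in> S \<Longrightarrow> (a, b) \<in> r \<Longrightarrow> (c \<cdot> a, c \<cdot> b) \<in> r"
    and right: "\<And>a b c. c \<in> S \<Longrightarrow> (a, b) \<in> r \<Longrightarrow> (a \<cdot> c, b \<cdot> c) \<in> r"
  shows "is_congruence S f r"
proof -
  have "(a \<cdot> c, b \<cdot> d) \<in> r" if "(a, b) \<in> r" "(c, d) \<in> r" for a b c d
  proof -
    have "c \<in> S" "b \<in> S" using assms(1) that by (auto simp: equiv_def)
    then have "(a \<cdot> c, b \<cdot> c) \<in> r" "(b \<cdot> c, b \<cdot> d) \<in> r" using left right that by blast+
    then show ?thesis using assms(1) unfolding equiv_def by (blast dest: transD)
  qed
  then show ?thesis using assms(1) unfolding is_congruence_def by blast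
qed

lemma is_congruence_Int:
  assumes "is_congruence S f r" "is_congruence S f s"
  shows "is_congruence S f (r \<inter> s)"
proof -
  interpret r: congruence_on S f r by unfold_locales fact
  interpret s: congruence_on S f s by unfold_locales fact
  have "equiv S (r \<inter> s)"
    using r.equivalence s.equivalence unfolding equiv_def by (auto simp: refl_on_def sym_Int trans_Int)
  then show ?thesis unfolding is_congruence_def using r.mult s.mult by blast
qed

lemma is_congruence_Id_on: "is_congruence S f (Id_on S)"
  unfolding is_congruence_def equiv_def by (auto simp: refl_on_def sym_def trans_def)

text \<open>The least element is the intersection of all congruences containing \<open>X\<close>.
  The predicate \<open>P\<close> is a parameter so that the definitions of \<open>nu\<close> and
  \<open>lam\<close> by \<open>LEAST\<close> fit once their conditions are rewritten as containment
  of a set of pairs.\<close>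

lemma Least_congruence:
  assumes X: "X \<subseteq> S \<times> S" and P: "\<And>r. P r \<longleftrightarrow> is_congruence S f r \<and> X \<subseteq> r"
  defines "l \<equiv> LEAST r. P r"
  shows "is_congruence S f l" "X \<subseteq> l" "\<And>r. is_congruence S f r \<Longrightarrow> X \<subseteq> r \<Longrightarrow> l \<subseteq> r"
proof -
  define C where "C = {r. is_congruence S f r \<and> X \<subseteq> r}"
  have "is_congruence S f (S \<times> S)"
    unfolding is_congruence_def equiv_def by (auto simp: refl_on_def sym_def trans_def)
  \<comment> \<open>The universal relation makes the family \<open>C\<close> nonempty, so that its
    intersection is a relation on \<open>S\<close>.\<close>
  then have SS: "S \<times> S \<in> C" using X by (simp add: C_def)
  have cong: "congruence_on S f r" if "r \<in> C" for r
    using that by unfold_locales (simp add: C_def)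
  have "equiv S (\<Inter>C)"
  proof (intro equivI refl_onI symI transI InterI)
    show "\<Inter>C \<subseteq> S \<times> S" using SS by blast
  next
    fix a r assume "a \<in> S" "r \<in> C"
    then show "(a, a) \<in> r" by (rule congruence_on.refl[OF cong, rotated])
  next
    fix a b r assume "(a, b) \<in> \<Inter>C" "r \<in> C"
    then show "(b, a) \<in> r" using congruence_on.sym[OF cong, of r a b] by blast
  next
    fix a b c r assume "(a, b) \<in> \<Inter>C" "(b, c) \<in> \<Inter>C" and r: "r \<in> C"
    then show "(a, c) \<in> r" using congruence_on.trans[OF cong[OF r], of a b c] by blast
  qed
  moreover have "(a \<cdot> c, b \<cdot> d) \<in> \<Inter>C" if "(a, b) \<in> \<Inter>C" "(c, d) \<in> \<Inter>C" for a b c d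
    using that congruence_on.mult[OF cong, of _ a b c d] by blast
  ultimately have cC: "is_congruence S f (\<Inter>C)"
    unfolding is_congruence_def by blast
  have XC: "X \<subseteq> \<Inter>C" and least: "\<And>r. is_congruence S f r \<Longrightarrow> X \<subseteq> r \<Longrightarrow> \<Inter>C \<subseteq> r"
    by (auto simp: C_def)
  have "l = \<Inter>C"
    unfolding l_def P using cC XC least by (intro Least_equality) blast+
  then show "is_congruence S f l" "X \<subseteq> l" "\<And>r. is_congruence S f r \<Longrightarrow> X \<subseteq> r \<Longrightarrow> l \<subseteq> r"
    using cC XC least by simp_all
qed

end

text \<open>Commuting idempotents make inverses unique, as two inverses \<open>x\<close>,
  \<open>y\<close> of \<open>a\<close> both equal \<open>y a x\<close>. Now
  \<open>\<iota> a e\<close> is an inverse of \<open>e a\<close>, hence equal to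
  \<open>\<iota> (e a)\<close>, and therefore commutes with \<open>e a\<close>; centrality of
  \<open>e\<close> follows.\<close>

lemma (in cr_semigroup) clifford_of_commuting_idempotents:
  assumes comm: "\<And>e g. e \<in> E \<Longrightarrow> g \<in> E \<Longrightarrow> e \<cdot> g = g \<cdot> e"
  shows "is_clifford S f"
proof -
  have inverse_unique: "x = y"
    if "a \<in> S" "x \<in> S" "y \<in> S" "a \<cdot> x \<cdot> a = a" "x \<cdot> a \<cdot> x = x" "a \<cdot> y \<cdot> a = a" "y \<cdot> a \<cdot> y = y" for a x y
  proof -
    have idem: "u \<cdot> v \<in> E" if "u \<in> S" "v \<in> S" "u \<cdot> v \<cdot> u = u" for u v
    proof (rule idemI)
      have "u \<cdot> v \<cdot> (u \<cdot> v) = u \<cdot> v \<cdot> u \<cdot> v" using that(1,2) by simp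
      then show "u \<cdot> v \<cdot> (u \<cdot> v) = u \<cdot> v" using that(3) by simp
    qed (use that in simp)
    note E = idem[OF that(1,2,4)] idem[OF that(2,1,5)] idem[OF that(1,3,6)] idem[OF that(3,1,7)]
    have "x = (x \<cdot> a) \<cdot> (y \<cdot> a) \<cdot> x"
    proof -
      have "(x \<cdot> a) \<cdot> (y \<cdot> a) \<cdot> x = x \<cdot> (a \<cdot> y \<cdot> a) \<cdot> x" using that(1-3) by simp
      then show ?thesis unfolding that(6) that(5) by simp
    qed
    also have "\<dots> = (y \<cdot> a) \<cdot> (x \<cdot> a) \<cdot> x" using comm[OF E(2,4)] by simp
    also have "\<dots> = y \<cdot> a \<cdot> (x \<cdot> a \<cdot> x)" using that(1-3) by simp
    also have "\<dots> = y \<cdot> a \<cdot> x" unfolding that(5) ..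
    finally have 1: "x = y \<cdot> a \<cdot> x" .
    have "y = y \<cdot> (a \<cdot> x) \<cdot> (a \<cdot> y)"
    proof -
      have "y \<cdot> (a \<cdot> x) \<cdot> (a \<cdot> y) = y \<cdot> (a \<cdot> x \<cdot> a) \<cdot> y" using that(1-3) by simp
      then show ?thesis unfolding that(4) that(7) by simp
    qed
    also have "\<dots> = y \<cdot> ((a \<cdot> x) \<cdot> (a \<cdot> y))" using that(1-3) by simp
    also have "\<dots> = y \<cdot> ((a \<cdot> y) \<cdot> (a \<cdot> x))" using comm[OF E(1,3)] by simp
    also have "\<dots> = (y \<cdot> a \<cdot> y) \<cdot> a \<cdot> x" using that(1-3) by simp
    also have "\<dots> = y \<cdot> a \<cdot> x" unfolding that(7) ..
    finally show ?thesis using 1 by simp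
  qed
  have "e \<cdot> a = a \<cdot> e" if e: "e \<in> E" and a: "a \<in> S" for e a
  proof -
    have S: "e \<in> S" "e \<cdot> a \<in> S" "\<iota> a \<cdot> e \<in> S" using e a by simp_all
    have c: "a\<^sup>0 \<cdot> e = e \<cdot> a\<^sup>0" "a\<^sup>0 \<cdot> (e \<cdot> x) = e \<cdot> (a\<^sup>0 \<cdot> x)" if "x \<in> S" for x
      using comm[of "a\<^sup>0" e] e a that by (simp_all flip: assoc)
    have "(e \<cdot> a) \<cdot> (\<iota> a \<cdot> e) \<cdot> (e \<cdot> a) = e \<cdot> a"
      using a e c by simp
    moreover have "(\<iota> a \<cdot> e) \<cdot> (e \<cdot> a) \<cdot> (\<iota> a \<cdot> e) = \<iota> a \<cdot> e"
      using a e by (simp flip: c)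
    ultimately have "\<iota> a \<cdot> e = \<iota> (e \<cdot> a)"
      using S inverse_unique[of "e \<cdot> a" "\<iota> a \<cdot> e" "\<iota> (e \<cdot> a)"] by simp
    then have "(e \<cdot> a) \<cdot> (\<iota> a \<cdot> e) = (\<iota> a \<cdot> e) \<cdot> (e \<cdot> a)" using S(2) by simp
    then have "e \<cdot> a\<^sup>0 = \<iota> a \<cdot> (e \<cdot> a)" using a e c(1)[OF a] by simp
    \<comment> \<open>Here the left side is \<open>a a\<^sup>0 e = a e\<close> and the right side is
      \<open>a\<^sup>0 e a = e a\<close>, since \<open>e\<close> commutes with
      \<open>a\<^sup>0\<close>.\<close>
    then have "a \<cdot> (e \<cdot> a\<^sup>0) = a \<cdot> (\<iota> a \<cdot> (e \<cdot> a))" by simp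
    then show ?thesis
      using a e c(2)[OF a] c(1)[OF a, symmetric] by simp
  qed
  then show ?thesis using cr unfolding is_clifford_def by blast
qed

section \<open>Quotients of completely regular semigroups\<close>

locale cr_congruence = cr_semigroup S f + congruence_on S f r
  for S :: "'a set" and f (infixl "\<cdot>" 70) and r
begin

sublocale quotient: cr_semigroup "S // r" qmult
proof
  interpret q: semigroup_on "S // r" qmult by (rule semigroup_quotient)
  show "completely_regular (S // r) qmult"
  proof (rule q.completely_regularI)
    fix A assume "A \<in> S // r"
    then obtain a where "a \<in> S" "A = cls a" by (elim quotientE)
    then show "\<exists>X\<in>S // r. qmult (qmult A X) A = A \<and> qmult A X = qmult X A"
      by (intro bexI[of _ "cls (\<iota> a)"]) (simp_all add: qmult_cls cls_in)
  qed
qed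

lemma cls_zero: "a \<in> S \<Longrightarrow> quotient.zero_of (cls a) = cls (a\<^sup>0)"
  using quotient.zero_eqI[of "cls a" "cls (\<iota> a)"] by (simp add: qmult_cls cls_in)

text \<open>The class of \<open>a\<^sup>0\<close> is the corresponding idempotent of the quotient,
  so it depends only on the class of \<open>a\<close>.\<close>

lemma zero_cong: "(a, b) \<in> r \<Longrightarrow> (a\<^sup>0, b\<^sup>0) \<in> r"
  using cls_zero cls_eq_iff in_carrier zero_in by metis

lemma square_iff: "a \<in> S \<Longrightarrow> (a \<cdot> a, a) \<in> r \<longleftrightarrow> (a, a\<^sup>0) \<in> r"
proof
  assume a: "a \<in> S" and "(a \<cdot> a, a) \<in> r"
  from mult[OF this(2) refl[of "\<iota> a"]] show "(a, a\<^sup>0) \<in> r" using a by simp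
next
  assume a: "a \<in> S" and h: "(a, a\<^sup>0) \<in> r"
  have "(a \<cdot> a, a\<^sup>0 \<cdot> a) \<in> r" using mult[OF h refl[OF a]] .
  then show "(a \<cdot> a, a) \<in> r" using a by simp
qed

text \<open>If \<open>a\<close> is related to an idempotent \<open>e\<close>, then
  \<open>a\<^sup>0\<close> is related to \<open>e\<^sup>0 = e\<close>; so \<open>a\<^sup>0\<close>
  can always serve as the idempotent witness.\<close>

lemma kernel_iff: "a \<in> cong_kernel S f r \<longleftrightarrow> (a, a\<^sup>0) \<in> r"
proof
  assume "a \<in> cong_kernel S f r"
  then obtain e where e: "e \<in> E" "(a, e) \<in> r" by (auto simp: cong_kernel_def)
  then have "(a\<^sup>0, e) \<in> r" using zero_cong[of a e] by simp
  then show "(a, a\<^sup>0) \<in> r" using e trans sym by blast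
next
  assume "(a, a\<^sup>0) \<in> r"
  then show "a \<in> cong_kernel S f r"
    unfolding cong_kernel_def using in_carrier(1) zero_idem by blast
qed

text \<open>Lallement's lemma: an idempotent class contains an idempotent, here
  \<open>a\<^sup>0\<close> for any representative \<open>a\<close>.\<close>

lemma idem_quotient:
  "A \<in> idempotents (S // r) qmult \<longleftrightarrow> (\<exists>e\<in>E. A = cls e)"
proof
  assume A: "A \<in> idempotents (S // r) qmult"
  then obtain a where a: "a \<in> S" "A = cls a" using quotient.idem_in quotientE by metis
  then have "(a, a\<^sup>0) \<in> r" using A cls_idem_iff square_iff by simp
  then have "A = cls (a\<^sup>0)" using a cls_eq_iff by simp
  then show "\<exists>e\<in>E. A = cls e" using a zero_idem by blast
next
  assume "\<exists>e\<in>E. A = cls e"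
  then show "A \<in> idempotents (S // r) qmult" using cls_idem_iff refl by auto
qed

text \<open>Idempotents of the quotient are classes of idempotents, and a class is idempotent iff
  its representative is related to its own zero. The condition thus asks that \<open>r\<close>
  contain a fixed set of pairs, as \<open>Least_congruence\<close> requires.\<close>

lemma orthodox_congruence_iff:
  "orthodox_congruence S f r \<longleftrightarrow> (\<forall>e\<in>E. \<forall>g\<in>E. (e \<cdot> g, (e \<cdot> g)\<^sup>0) \<in> r)"
proof -
  have "is_regular (S // r) qmult"
    unfolding is_regular_def using quotient.semigroup quotient.inverse_in quotient.inverse_left
      quotient.zero_right quotient.assoc by metis
  then have "orthodox_congruence S f r \<longleftrightarrow>
      (\<forall>e\<in>E. \<forall>g\<in>E. qmult (cls e) (cls g) \<in> idempotents (S // r) qmult)"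
    unfolding orthodox_congruence_def is_orthodox_def using congruence idem_quotient by metis
  then show ?thesis by (simp add: qmult_cls cls_idem_iff square_iff del: assoc)
qed

text \<open>Commutation of the idempotents of the quotient already forces their centrality, by
  \<open>clifford_of_commuting_idempotents\<close>; again the condition is containment of a fixed
  set of pairs.\<close>

lemma clifford_congruence_iff:
  "clifford_congruence S f r \<longleftrightarrow> (\<forall>e\<in>E. \<forall>g\<in>E. (e \<cdot> g, g \<cdot> e) \<in> r)"
proof
  assume "clifford_congruence S f r"
  then have "qmult (cls e) (cls g) = qmult (cls g) (cls e)" if "e \<in> E" "g \<in> E" for e g
    unfolding clifford_congruence_def is_clifford_def
    using that idem_quotient cls_in idem_in by blast
  then show "\<forall>e\<in>E. \<forall>g\<in>E. (e \<cdot> g, g \<cdot> e) \<in> r"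
    by (simp add: qmult_cls cls_eq_iff)
next
  assume h: "\<forall>e\<in>E. \<forall>g\<in>E. (e \<cdot> g, g \<cdot> e) \<in> r"
  have "is_clifford (S // r) qmult"
  proof (rule quotient.clifford_of_commuting_idempotents)
    fix A B assume "A \<in> idempotents (S // r) qmult" "B \<in> idempotents (S // r) qmult"
    then obtain e g where "e \<in> E" "A = cls e" "g \<in> E" "B = cls g"
      by (auto simp: idem_quotient)
    then show "qmult A B = qmult B A" using h by (simp add: qmult_cls cls_eq_iff)
  qed
  then show "clifford_congruence S f r"
    unfolding clifford_congruence_def using congruence by blast
qed

end

section \<open>Inverses in orthodox semigroups\<close>

locale orthodox_on = semigroup_on S f for S :: "'a set" and f (infixl "\<cdot>" 70) +
  assumes orthodox: "is_orthodox S f"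
begin

lemma idem_mult: "e \<in> E \<Longrightarrow> g \<in> E \<Longrightarrow> e \<cdot> g \<in> E"
  using orthodox by (simp add: is_orthodox_def)

text \<open>Inverses in the sense of regular semigroups: an element may have many, unlike the group
  inverse \<open>cr_inverse\<close>.\<close>

definition inverses :: "'a \<Rightarrow> 'a set" where
  "inverses a = {x \<in> S. a \<cdot> x \<cdot> a = a \<and> x \<cdot> a \<cdot> x = x}"

lemma inversesD:
  assumes "x \<in> inverses a"
  shows "x \<in> S" "a \<cdot> x \<cdot> a = a" "x \<cdot> a \<cdot> x = x"
  using assms by (simp_all add: inverses_def)

lemma product_idem:
  assumes "a \<in> S" "x \<in> S" "a \<cdot> x \<cdot> a = a"
  shows "a \<cdot> x \<in> E"
proof (rule idemI)
  have "a \<cdot> x \<cdot> (a \<cdot> x) = a \<cdot> x \<cdot> a \<cdot> x" using assms(1,2) by simp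
  then show "a \<cdot> x \<cdot> (a \<cdot> x) = a \<cdot> x" using assms(3) by simp
qed (use assms in simp)

lemma regular_simps:
  assumes "a \<in> S" "x \<in> S" "a \<cdot> x \<cdot> a = a"
  shows "a \<cdot> (x \<cdot> a) = a" "z \<in> S \<Longrightarrow> a \<cdot> (x \<cdot> (a \<cdot> z)) = a \<cdot> z"
proof -
  show 1: "a \<cdot> (x \<cdot> a) = a" using assms by simp
  show "a \<cdot> (x \<cdot> (a \<cdot> z)) = a \<cdot> z" if "z \<in> S"
    using that assms(1,2) assoc[of a "x \<cdot> a" z] unfolding 1 by simp
qed

lemma inverses_nonempty:
  assumes "a \<in> S"
  shows "inverses a \<noteq> {}"
proof -
  obtain x where x: "x \<in> S" "a \<cdot> x \<cdot> a = a"
    using orthodox assms by (auto simp: is_orthodox_def is_regular_def)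
  have "x \<cdot> a \<cdot> x \<in> inverses a"
    using regular_simps[OF assms x] assms x(1) by (simp add: inverses_def)
  then show ?thesis by blast
qed

lemma idem_inverse: "e \<in> E \<Longrightarrow> e \<in> inverses e"
  by (simp add: inverses_def)

text \<open>With the idempotents \<open>e = x a\<close> and \<open>g = b y\<close>, the product
  \<open>a b y x a b\<close> equals \<open>a g e b = a e g e g b\<close>, and orthodoxy contracts
  \<open>e g e g\<close> to \<open>e g\<close>. The other identity contracts \<open>g e g e\<close>
  in the same way.\<close>

lemma inverses_mult:
  assumes "a \<in> S" "b \<in> S" "x \<in> inverses a" "y \<in> inverses b"
  shows "y \<cdot> x \<in> inverses (a \<cdot> b)"
proof -
  note x = inversesD[OF assms(3)] and y = inversesD[OF assms(4)]
  define e g where "e = x \<cdot> a" and "g = b \<cdot> y"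
  have E: "e \<in> E" "g \<in> E"
    using product_idem assms(1,2) x y by (auto simp: e_def g_def simp del: assoc)
  note S = assms(1,2) x(1) y(1) idem_in[OF E(1)] idem_in[OF E(2)]
  have eg: "e \<cdot> g \<cdot> (e \<cdot> g) = e \<cdot> g" "g \<cdot> e \<cdot> (g \<cdot> e) = g \<cdot> e"
    using idem_mult E idem by blast+
  have ae: "a \<cdot> e = a" and ex: "e \<cdot> x = x" and gb: "g \<cdot> b = b" and yg: "y \<cdot> g = y"
    using x y S by (simp_all add: e_def g_def)
  have "(a \<cdot> b) \<cdot> (y \<cdot> x) \<cdot> (a \<cdot> b) = a \<cdot> (g \<cdot> e) \<cdot> b"
    using S by (simp add: e_def g_def)
  also have "\<dots> = (a \<cdot> e) \<cdot> (g \<cdot> e) \<cdot> (g \<cdot> b)" unfolding ae gb ..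
  also have "\<dots> = a \<cdot> (e \<cdot> g \<cdot> (e \<cdot> g)) \<cdot> b" using S(1,2,5,6) by simp
  also have "\<dots> = (a \<cdot> e) \<cdot> (g \<cdot> b)" unfolding eg using S(1,2,5,6) by simp
  also have "\<dots> = a \<cdot> b" unfolding ae gb ..
  finally have 1: "(a \<cdot> b) \<cdot> (y \<cdot> x) \<cdot> (a \<cdot> b) = a \<cdot> b" .
  have "(y \<cdot> x) \<cdot> (a \<cdot> b) \<cdot> (y \<cdot> x) = y \<cdot> (e \<cdot> g) \<cdot> x"
    using S by (simp add: e_def g_def)
  also have "\<dots> = (y \<cdot> g) \<cdot> (e \<cdot> g) \<cdot> (e \<cdot> x)" unfolding ex yg ..
  also have "\<dots> = y \<cdot> (g \<cdot> e \<cdot> (g \<cdot> e)) \<cdot> x" using S(3-6) by simp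
  also have "\<dots> = (y \<cdot> g) \<cdot> (e \<cdot> x)" unfolding eg using S(3-6) by simp
  also have "\<dots> = y \<cdot> x" unfolding ex yg ..
  finally show ?thesis using 1 S by (simp add: inverses_def del: assoc)
qed

text \<open>The hypotheses say that \<open>e\<close> and \<open>g\<close> are
  \<open>green_R\<close>-related and \<open>g\<close> and \<open>h\<close> are
  \<open>green_L\<close>-related; in a band such idempotents lie in one rectangular band. The proof
  contracts \<open>h e h e\<close> to \<open>h e\<close>.\<close>

lemma rectangular:
  assumes "e \<in> E" "g \<in> E" "h \<in> E"
    and "e \<cdot> g = g" "g \<cdot> e = e" "g \<cdot> h = g" "h \<cdot> g = h"
  shows "e \<cdot> h \<cdot> e = e" "h \<cdot> e \<cdot> h = h"
proof -
  note S = assms(1-3)[THEN idem_in]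
  have he: "h \<cdot> e \<cdot> (h \<cdot> e) = h \<cdot> e" using idem_mult assms idem by blast
  have "e \<cdot> h \<cdot> e = (g \<cdot> h) \<cdot> e \<cdot> h \<cdot> e" unfolding assms(6) assms(5) ..
  also have "\<dots> = g \<cdot> (h \<cdot> e \<cdot> (h \<cdot> e))" using S by simp
  also have "\<dots> = (g \<cdot> h) \<cdot> e" unfolding he using S by simp
  also have "\<dots> = e" unfolding assms(6) assms(5) ..
  finally show "e \<cdot> h \<cdot> e = e" .
  have "h \<cdot> e \<cdot> h = h \<cdot> e \<cdot> (h \<cdot> g)" unfolding assms(7) ..
  also have "\<dots> = h \<cdot> e \<cdot> (h \<cdot> (e \<cdot> g))" unfolding assms(4) ..
  also have "\<dots> = (h \<cdot> e \<cdot> (h \<cdot> e)) \<cdot> g" using S by simp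
  also have "\<dots> = h \<cdot> (e \<cdot> g)" unfolding he using S by simp
  also have "\<dots> = h" unfolding assms(4) assms(7) ..
  finally show "h \<cdot> e \<cdot> h = h" .
qed

text \<open>The idempotents \<open>x b\<close>, \<open>x a\<close>, \<open>y a\<close> and, dually,
  \<open>a y\<close>, \<open>a x\<close>, \<open>b x\<close> form chains to which
  \<open>rectangular\<close> applies. This allows the factors \<open>h\<close> and \<open>h'\<close>
  of \<open>y = h x h'\<close> to be absorbed next to \<open>b\<close>.\<close>

lemma common_inverse:
  assumes ab: "a \<in> S" "b \<in> S" and "x \<in> inverses a" "x \<in> inverses b" "y \<in> inverses a"
  shows "y \<in> inverses b"
proof -
  note xa = inversesD[OF assms(3)] and xb = inversesD[OF assms(4)] and ya = inversesD[OF assms(5)]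
  define e g h where "e = x \<cdot> b" and "g = x \<cdot> a" and "h = y \<cdot> a"
  define e' g' h' where "e' = b \<cdot> x" and "g' = a \<cdot> x" and "h' = a \<cdot> y"
  note defs = e_def g_def h_def e'_def g'_def h'_def
  have E: "e \<in> E" "g \<in> E" "h \<in> E" "e' \<in> E" "g' \<in> E" "h' \<in> E"
    unfolding defs using product_idem ab xa xb ya by blast+
  note S = ab xa(1) ya(1) E[THEN idem_in]
  note simps = regular_simps[OF ab(1) xa(1,2)] regular_simps[OF xa(1) ab(1) xa(3)]
    regular_simps[OF ab(2) xb(1,2)] regular_simps[OF xb(1) ab(2) xb(3)]
    regular_simps[OF ab(1) ya(1,2)] regular_simps[OF ya(1) ab(1) ya(3)]
  have "e \<cdot> g = g" "g \<cdot> e = e" "g \<cdot> h = g" "h \<cdot> g = h"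
    unfolding defs using S(1-4) by (simp_all add: simps)
  note eh = rectangular[OF E(1-3) this]
  have "h' \<cdot> g' = g'" "g' \<cdot> h' = h'" "g' \<cdot> e' = g'" "e' \<cdot> g' = e'"
    unfolding defs using S(1-4) by (simp_all add: simps)
  note eh' = rectangular[OF E(6,5,4) this]
  have be: "b \<cdot> e = b" and eb: "e' \<cdot> b = b" and ex: "e \<cdot> x = x" and xe: "x \<cdot> e' = x"
    and gh: "g' \<cdot> h' = h'" "h \<cdot> g = h"
    unfolding defs using S(1-4) by (simp_all add: simps)
  \<comment> \<open>Writing \<open>x = e x e'\<close> exposes \<open>e h e\<close> and
    \<open>e' h' e'\<close>, which collapse to \<open>e\<close> and \<open>e'\<close>.\<close>
  have x_mid: "(e \<cdot> h) \<cdot> x \<cdot> (h' \<cdot> e') = x"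
  proof -
    have "(e \<cdot> h) \<cdot> x \<cdot> (h' \<cdot> e') = (e \<cdot> h) \<cdot> (e \<cdot> x \<cdot> e') \<cdot> (h' \<cdot> e')" unfolding ex xe ..
    also have "\<dots> = (e \<cdot> h \<cdot> e) \<cdot> x \<cdot> (e' \<cdot> h' \<cdot> e')" using S(3-) by simp
    finally show ?thesis unfolding eh eh' ex xe .
  qed
  have y: "y = h \<cdot> x \<cdot> h'"
    unfolding h_def h'_def using S(1-4) by (simp add: simps)
  have "b \<cdot> y \<cdot> b = (b \<cdot> e) \<cdot> (h \<cdot> x \<cdot> h') \<cdot> (e' \<cdot> b)" unfolding be eb y[symmetric] ..
  also have "\<dots> = b \<cdot> ((e \<cdot> h) \<cdot> x \<cdot> (h' \<cdot> e')) \<cdot> b" using S by simp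
  also have "\<dots> = b" unfolding x_mid using xb by simp
  finally have 1: "b \<cdot> y \<cdot> b = b" .
  \<comment> \<open>The second identity is reduced to \<open>h' b h = a\<close>: since
    \<open>y h' = y\<close> and \<open>h y = y\<close>, it turns \<open>y b y\<close> into
    \<open>y a y\<close>.\<close>
  have "h' \<cdot> b \<cdot> h = a \<cdot> (x \<cdot> h' \<cdot> b \<cdot> h \<cdot> x) \<cdot> a"
  proof -
    have "(g' \<cdot> h') \<cdot> b \<cdot> (h \<cdot> g) = a \<cdot> (x \<cdot> h' \<cdot> b \<cdot> h \<cdot> x) \<cdot> a"
      unfolding g_def g'_def using S by simp
    then show ?thesis unfolding gh .
  qed
  also have "x \<cdot> h' \<cdot> b \<cdot> h \<cdot> x = (x \<cdot> e') \<cdot> h' \<cdot> (e' \<cdot> b \<cdot> e) \<cdot> h \<cdot> (e \<cdot> x)"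
    unfolding ex xe eb be ..
  also have "\<dots> = x \<cdot> (e' \<cdot> h' \<cdot> e') \<cdot> b \<cdot> (e \<cdot> h \<cdot> e) \<cdot> x" using S by simp
  also have "\<dots> = x \<cdot> b \<cdot> x" unfolding eh eh' xe using S ex by simp
  finally have hbh: "h' \<cdot> b \<cdot> h = a" unfolding xb xa .
  have "y \<cdot> b \<cdot> y = y \<cdot> (h' \<cdot> b \<cdot> h) \<cdot> y"
    unfolding h_def h'_def using S(1-4) by (simp add: simps)
  also have "\<dots> = y" unfolding hbh ya ..
  finally show ?thesis using 1 ya(1) by (simp add: inverses_def del: assoc)
qed

lemma inverses_eq: "a \<in> S \<Longrightarrow> b \<in> S \<Longrightarrow> x \<in> inverses a \<Longrightarrow> x \<in> inverses b \<Longrightarrow> inverses a = inverses b"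
  using common_inverse by blast

text \<open>On an orthodox semigroup this is the well-known least congruence whose quotient is an
  inverse semigroup.\<close>

definition same_inverses :: "'a rel" where
  "same_inverses = {(a, b) \<in> S \<times> S. inverses a = inverses b}"

lemma same_inverses_congruence: "is_congruence S f same_inverses"
proof -
  have "(a \<cdot> c, b \<cdot> d) \<in> same_inverses" if h: "(a, b) \<in> same_inverses" "(c, d) \<in> same_inverses" for a b c d
  proof -
    have S: "a \<in> S" "b \<in> S" "c \<in> S" "d \<in> S" and eq: "inverses a = inverses b" "inverses c = inverses d"
      using h by (auto simp: same_inverses_def)
    obtain x y where "x \<in> inverses a" "y \<in> inverses c" using S inverses_nonempty by blast
    then have "y \<cdot> x \<in> inverses (a \<cdot> c)" "y \<cdot> x \<in> inverses (b \<cdot> d)"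
      using inverses_mult S eq by blast+
    then show ?thesis unfolding same_inverses_def using S inverses_eq[of "a \<cdot> c" "b \<cdot> d"] by simp
  qed
  moreover have "equiv S same_inverses"
    by (auto simp: same_inverses_def equiv_def refl_on_def sym_def trans_def)
  ultimately show ?thesis unfolding is_congruence_def by blast
qed

text \<open>An idempotent \<open>e\<close> is its own inverse, hence an inverse of \<open>a\<close>.
  Then \<open>a e\<close> and \<open>e a\<close> are idempotent, and so is their product
  \<open>a e a = a\<close>.\<close>

lemma same_inverses_idem:
  assumes "(a, e) \<in> same_inverses" "e \<in> E"
  shows "a \<in> E"
proof -
  have a: "a \<in> S" "e \<in> inverses a"
    using assms idem_inverse by (auto simp: same_inverses_def)
  note e = inversesD[OF a(2)]
  have "a \<cdot> e \<in> E" "e \<cdot> a \<in> E" using product_idem a(1) e by blast+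
  then have "(a \<cdot> e) \<cdot> (e \<cdot> a) \<in> E" by (rule idem_mult)
  moreover have "(a \<cdot> e) \<cdot> (e \<cdot> a) = a \<cdot> e \<cdot> a" using a(1) assms(2) by simp
  ultimately show ?thesis using e by simp
qed

text \<open>The idempotent \<open>g e\<close> is an inverse both of itself and of
  \<open>e g\<close>, and one shared inverse is enough.\<close>

lemma same_inverses_commute:
  assumes "e \<in> E" "g \<in> E"
  shows "(e \<cdot> g, g \<cdot> e) \<in> same_inverses"
proof -
  have E: "e \<cdot> g \<in> E" "g \<cdot> e \<in> E" using idem_mult assms by blast+
  have "e \<cdot> (g \<cdot> (e \<cdot> g)) = e \<cdot> g" "g \<cdot> (e \<cdot> (g \<cdot> e)) = g \<cdot> e" using idem[OF E(1)] idem[OF E(2)] assms by simp_all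
  then have "g \<cdot> e \<in> inverses (e \<cdot> g)" using assms by (simp add: inverses_def)
  then show ?thesis
    unfolding same_inverses_def using inverses_eq[OF _ _ _ idem_inverse[OF E(2)]] assms by simp
qed

end

section \<open>The congruences \<open>\<nu>\<close>, \<open>\<lambda>\<close> and \<open>\<mu>\<close>\<close>

context cr_semigroup
begin

lemma cr_congruenceI: "is_congruence S f r \<Longrightarrow> cr_congruence S f r"
  by unfold_locales

text \<open>Identifies \<open>nu\<close> as the congruence generated by the pairs
  \<open>(e g, g e)\<close> of products of idempotents.\<close>

lemma nu_props:
  shows nu_congruence: "is_congruence S f (nu S f)"
    and nu_commute: "e \<in> E \<Longrightarrow> g \<in> E \<Longrightarrow> (e \<cdot> g, g \<cdot> e) \<in> nu S f"
    and nu_least: "is_congruence S f r \<Longrightarrow> (\<And>e g. e \<in> E \<Longrightarrow> g \<in> E \<Longrightarrow> (e \<cdot> g, g \<cdot> e) \<in> r) \<Longrightarrow> nu S f \<subseteq> r"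
proof -
  define X where "X = {(e \<cdot> g, g \<cdot> e) |e g. e \<in> E \<and> g \<in> E}"
  have iff: "clifford_congruence S f r \<longleftrightarrow> is_congruence S f r \<and> X \<subseteq> r" for r
  proof (cases "is_congruence S f r")
    case True
    show ?thesis
      unfolding cr_congruence.clifford_congruence_iff[OF cr_congruenceI[OF True]] X_def using True by blast
  qed (simp add: clifford_congruence_def)
  have "X \<subseteq> S \<times> S" unfolding X_def using closed idem_in by blast
  note least = Least_congruence[OF this iff, folded nu_def]
  show "is_congruence S f (nu S f)" by (rule least)
  show "(e \<cdot> g, g \<cdot> e) \<in> nu S f" if "e \<in> E" "g \<in> E"
    using least(2) that unfolding X_def by blast
  show "nu S f \<subseteq> r" if "is_congruence S f r" "\<And>e g. e \<in> E \<Longrightarrow> g \<in> E \<Longrightarrow> (e \<cdot> g, g \<cdot> e) \<in> r"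
    using that unfolding X_def by (intro least) (auto simp: X_def)
qed

text \<open>Identifies \<open>lam\<close> as the congruence generated by the pairs
  \<open>(e g, (e g)\<^sup>0)\<close> for idempotents \<open>e\<close>, \<open>g\<close>.\<close>

lemma lam_props:
  shows lam_congruence: "is_congruence S f (lam S f)"
    and lam_orthodox: "orthodox_congruence S f (lam S f)"
    and lam_least: "orthodox_congruence S f r \<Longrightarrow> lam S f \<subseteq> r"
proof -
  define X where "X = {(e \<cdot> g, (e \<cdot> g)\<^sup>0) |e g. e \<in> E \<and> g \<in> E}"
  have iff: "orthodox_congruence S f r \<longleftrightarrow> is_congruence S f r \<and> X \<subseteq> r" for r
  proof (cases "is_congruence S f r")
    case True
    show ?thesis
      unfolding cr_congruence.orthodox_congruence_iff[OF cr_congruenceI[OF True]] X_def using True by blast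
  qed (simp add: orthodox_congruence_def)
  have "X \<subseteq> S \<times> S" unfolding X_def using closed idem_in zero_in by blast
  note least = Least_congruence[OF this iff, folded lam_def]
  show "is_congruence S f (lam S f)" by (rule least)
  show "orthodox_congruence S f (lam S f)" using least(1,2) iff by blast
  show "lam S f \<subseteq> r" if "orthodox_congruence S f r"
    using that least(3) iff by blast
qed

text \<open>The formula describes the largest congruence inside \<open>green_H\<close>: all
  translates of \<open>a\<close> and \<open>b\<close>, on either side or both, must have equal
  zeros. The four cases replace multipliers from a monoid with adjoined identity.\<close>

lemma mu_props:
  shows mu_eq: "mu S f = {(a, b) \<in> S \<times> S. a\<^sup>0 = b\<^sup>0 \<and>
      (\<forall>x\<in>S. (x \<cdot> a)\<^sup>0 = (x \<cdot> b)\<^sup>0 \<and> (a \<cdot> x)\<^sup>0 = (b \<cdot> x)\<^sup>0 \<and>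
        (\<forall>y\<in>S. (x \<cdot> (a \<cdot> y))\<^sup>0 = (x \<cdot> (b \<cdot> y))\<^sup>0))}" (is "_ = ?m")
    and mu_congruence: "is_congruence S f (mu S f)"
    and mu_greatest: "is_congruence S f r \<Longrightarrow> idempotent_separating S f r \<longleftrightarrow> r \<subseteq> mu S f"
proof -
  have cong: "is_congruence S f ?m"
  proof (rule is_congruenceI)
    show "equiv S ?m" by (auto simp: equiv_def refl_on_def sym_def trans_def)
  next
    fix a b c assume c: "c \<in> S" and ab: "(a, b) \<in> ?m"
    then have S: "a \<in> S" "b \<in> S" by simp_all
    have l: "(x \<cdot> a)\<^sup>0 = (x \<cdot> b)\<^sup>0" "(a \<cdot> x)\<^sup>0 = (b \<cdot> x)\<^sup>0" if "x \<in> S" for x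
      using ab that by simp_all
    have m: "(x \<cdot> (a \<cdot> y))\<^sup>0 = (x \<cdot> (b \<cdot> y))\<^sup>0" if "x \<in> S" "y \<in> S" for x y
      using ab that by simp
    have "(x \<cdot> (c \<cdot> a))\<^sup>0 = (x \<cdot> (c \<cdot> b))\<^sup>0" "(a \<cdot> (c \<cdot> x))\<^sup>0 = (b \<cdot> (c \<cdot> x))\<^sup>0" if "x \<in> S" for x
      using S c that l(1)[of "x \<cdot> c"] l(2)[of "c \<cdot> x"] by simp_all
    moreover have "(x \<cdot> (c \<cdot> (a \<cdot> y)))\<^sup>0 = (x \<cdot> (c \<cdot> (b \<cdot> y)))\<^sup>0"
      "(x \<cdot> (a \<cdot> (c \<cdot> y)))\<^sup>0 = (x \<cdot> (b \<cdot> (c \<cdot> y)))\<^sup>0" if "x \<in> S" "y \<in> S" for x y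
      using S c that m[of "x \<cdot> c" y] m[of x "c \<cdot> y"] by simp_all
    ultimately show "(c \<cdot> a, c \<cdot> b) \<in> ?m" "(a \<cdot> c, b \<cdot> c) \<in> ?m"
      using S c l[OF c] m[OF c] m[OF _ c] by simp_all
  qed
  have greatest: "r \<subseteq> ?m" if h: "is_congruence S f r" "idempotent_separating S f r" for r
  proof -
    interpret r: cr_congruence S f r using h by (intro cr_congruenceI)
    \<comment> \<open>Zeros of related elements are related idempotents, hence equal; this is then
      applied to all translates.\<close>
    have z: "a\<^sup>0 = b\<^sup>0" if "(a, b) \<in> r" for a b
      using h r.zero_cong[OF that] r.in_carrier[OF that] zero_idem
      unfolding idempotent_separating_def by blast
    show "r \<subseteq> ?m"
    proof (rule subrelI)
      fix a b assume ab: "(a, b) \<in> r"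
      have "(x \<cdot> a)\<^sup>0 = (x \<cdot> b)\<^sup>0" "(a \<cdot> x)\<^sup>0 = (b \<cdot> x)\<^sup>0" if "x \<in> S" for x
        using ab that r.mult r.refl by (blast intro: z)+
      moreover have "(x \<cdot> (a \<cdot> y))\<^sup>0 = (x \<cdot> (b \<cdot> y))\<^sup>0" if "x \<in> S" "y \<in> S" for x y
        using ab that r.mult r.refl by (blast intro: z)
      ultimately show "(a, b) \<in> ?m"
        using z[OF ab] r.in_carrier[OF ab] by blast
    qed
  qed
  have sep: "idempotent_separating S f r" if "r \<subseteq> ?m" for r
    unfolding idempotent_separating_def
  proof (intro ballI impI)
    fix e g assume eg: "e \<in> E" "g \<in> E" and "(e, g) \<in> r"
    then have "e\<^sup>0 = g\<^sup>0" using that by blast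
    then show "e = g" using eg by simp
  qed
  show eq: "mu S f = ?m"
    unfolding mu_def using cong sep[OF order_refl] greatest by (intro Greatest_equality) blast+
  show "is_congruence S f (mu S f)" unfolding eq by (rule cong)
  show "idempotent_separating S f r \<longleftrightarrow> r \<subseteq> mu S f" if "is_congruence S f r"
    unfolding eq using sep greatest[OF that] by blast
qed

lemma mu_zero: "(a, b) \<in> mu S f \<Longrightarrow> a\<^sup>0 = b\<^sup>0"
  unfolding mu_eq by blast

section \<open>Testing membership in \<open>mu\<close> by multiplication with idempotents\<close>

lemma green_H_mult_left:
  assumes S: "a \<in> S" "b \<in> S" "x \<in> S" and "a\<^sup>0 = b\<^sup>0" "(x\<^sup>0 \<cdot> a)\<^sup>0 = (x\<^sup>0 \<cdot> b)\<^sup>0"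
  shows "(x \<cdot> a)\<^sup>0 = (x \<cdot> b)\<^sup>0"
proof -
  have H: "(a, b) \<in> green_H S f" "(x\<^sup>0 \<cdot> a, x\<^sup>0 \<cdot> b) \<in> green_H S f"
    using assms by (simp_all add: green_H_iff)
  \<comment> \<open>The left multipliers between the two elements are \<open>x\<close> and
    \<open>\<iota> x\<close>, so \<open>x\<close> can be replaced by \<open>x\<^sup>0\<close> up to
    \<open>green_L\<close>.\<close>
  have L0: "(x \<cdot> c, x\<^sup>0 \<cdot> c) \<in> green_L S f" if "c \<in> S" for c
    unfolding green_L_iff using that S(3) inverse_in[OF S(3)]
    by (intro conjI bexI[of _ x] bexI[of _ "\<iota> x"]) simp_all
  have "(x \<cdot> a, x \<cdot> b) \<in> green_L S f"
    using L0[OF S(1)] L0[OF S(2)] H(2) unfolding green_H_def green_L_def by auto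
  \<comment> \<open>\<open>green_R\<close> is preserved by left multiplication, so this half needs
    only \<open>a\<^sup>0 = b\<^sup>0\<close>.\<close>
  moreover have "(x \<cdot> a, x \<cdot> b) \<in> green_R S f"
  proof -
    obtain s t where st: "s \<in> S" "a = b \<cdot> s" "t \<in> S" "b = a \<cdot> t"
      using H(1) unfolding green_H_def Int_iff green_R_iff by blast
    have "x \<cdot> a = x \<cdot> b \<cdot> s" using S(2,3) st(1) by (simp flip: st(2))
    moreover have "x \<cdot> b = x \<cdot> a \<cdot> t" using S(1,3) st(3) by (simp flip: st(4))
    ultimately show ?thesis using closed S st(1,3) unfolding green_R_iff by blast
  qed
  ultimately show ?thesis using green_H_iff unfolding green_H_def by blast
qed

lemma green_H_mult_right:
  assumes S: "a \<in> S" "b \<in> S" "x \<in> S" and "a\<^sup>0 = b\<^sup>0" "(a \<cdot> x\<^sup>0)\<^sup>0 = (b \<cdot> x\<^sup>0)\<^sup>0"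
  shows "(a \<cdot> x)\<^sup>0 = (b \<cdot> x)\<^sup>0"
proof -
  have H: "(a, b) \<in> green_H S f" "(a \<cdot> x\<^sup>0, b \<cdot> x\<^sup>0) \<in> green_H S f"
    using assms by (simp_all add: green_H_iff)
  have R0: "(c \<cdot> x, c \<cdot> x\<^sup>0) \<in> green_R S f" if "c \<in> S" for c
    unfolding green_R_iff using that S(3) inverse_in[OF S(3)]
    by (intro conjI bexI[of _ x] bexI[of _ "\<iota> x"]) simp_all
  have "(a \<cdot> x, b \<cdot> x) \<in> green_R S f"
    using R0[OF S(1)] R0[OF S(2)] H(2) unfolding green_H_def green_R_def by auto
  moreover have "(a \<cdot> x, b \<cdot> x) \<in> green_L S f"
  proof -
    obtain s t where st: "s \<in> S" "a = s \<cdot> b" "t \<in> S" "b = t \<cdot> a"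
      using H(1) unfolding green_H_def Int_iff green_L_iff by blast
    have "a \<cdot> x = s \<cdot> (b \<cdot> x)" using S(2,3) st(1) by (simp flip: st(2) assoc)
    moreover have "b \<cdot> x = t \<cdot> (a \<cdot> x)" using S(1,3) st(3) by (simp flip: st(4) assoc)
    ultimately show ?thesis using closed S st(1,3) unfolding green_L_iff by blast
  qed
  ultimately show ?thesis using green_H_iff unfolding green_H_def by blast
qed

lemma mu_idempotentsI:
  assumes S: "a \<in> S" "b \<in> S" and z: "a\<^sup>0 = b\<^sup>0"
    and l: "\<And>e. e \<in> E \<Longrightarrow> (e \<cdot> a)\<^sup>0 = (e \<cdot> b)\<^sup>0"
    and r: "\<And>e. e \<in> E \<Longrightarrow> (a \<cdot> e)\<^sup>0 = (b \<cdot> e)\<^sup>0"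
    and lr: "\<And>e g. e \<in> E \<Longrightarrow> g \<in> E \<Longrightarrow> (e \<cdot> (a \<cdot> g))\<^sup>0 = (e \<cdot> (b \<cdot> g))\<^sup>0"
  shows "(a, b) \<in> mu S f"
proof -
  have left: "(x \<cdot> a)\<^sup>0 = (x \<cdot> b)\<^sup>0" if "x \<in> S" for x
    using green_H_mult_left[OF S that z l[OF zero_idem[OF that]]] .
  have right: "(a \<cdot> x)\<^sup>0 = (b \<cdot> x)\<^sup>0" if "x \<in> S" for x
    using green_H_mult_right[OF S that z r[OF zero_idem[OF that]]] .
  have "(x \<cdot> (a \<cdot> y))\<^sup>0 = (x \<cdot> (b \<cdot> y))\<^sup>0" if x: "x \<in> S" and y: "y \<in> S" for x y
  proof -
    \<comment> \<open>Two-sided multipliers are treated one side at a time: first \<open>x\<close>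
      acting on \<open>a y\<^sup>0\<close> and \<open>b y\<^sup>0\<close>, then \<open>y\<close>
      acting on \<open>x a\<close> and \<open>x b\<close>.\<close>
    have "(x \<cdot> (a \<cdot> y\<^sup>0))\<^sup>0 = (x \<cdot> (b \<cdot> y\<^sup>0))\<^sup>0"
      using S y by (intro green_H_mult_left[OF _ _ x r[OF zero_idem[OF y]] lr[OF zero_idem[OF x] zero_idem[OF y]]]) simp_all
    then have "(x \<cdot> a \<cdot> y\<^sup>0)\<^sup>0 = (x \<cdot> b \<cdot> y\<^sup>0)\<^sup>0" using S x y by simp
    then have "(x \<cdot> a \<cdot> y)\<^sup>0 = (x \<cdot> b \<cdot> y)\<^sup>0"
      by (intro green_H_mult_right[OF _ _ y left[OF x]]) (use S x in simp_all)
    then show ?thesis using S x y by simp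
  qed
  then show ?thesis unfolding mu_eq using S z left right by blast
qed

lemma kernel_nu_subset_kernel_lam: "cong_kernel S f (nu S f) \<subseteq> cong_kernel S f (lam S f)"
proof
  interpret nu: cr_congruence S f "nu S f" by (rule cr_congruenceI[OF nu_congruence])
  interpret lam: cr_congruence S f "lam S f" by (rule cr_congruenceI[OF lam_congruence])
  interpret T: orthodox_on "S // lam S f" lam.qmult
    using lam_orthodox lam.semigroup_quotient
    by (simp add: orthodox_on_def orthodox_on_axioms_def orthodox_congruence_def)
  interpret T: congruence_on "S // lam S f" lam.qmult T.same_inverses
    by unfold_locales (rule T.same_inverses_congruence)
  \<comment> \<open>The pullback to \<open>S\<close> of the relation on the quotient. It makes
    idempotents commute and hence contains \<open>nu\<close>.\<close>
  define r where "r = {(a, b) \<in> S \<times> S. (lam.cls a, lam.cls b) \<in> T.same_inverses}"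
  have "equiv S r"
    unfolding r_def equiv_def refl_on_def sym_def trans_def
    using T.refl lam.cls_in T.sym T.trans by blast
  moreover have "(a \<cdot> c, b \<cdot> d) \<in> r" if "(a, b) \<in> r" "(c, d) \<in> r" for a b c d
    using that T.mult[of "lam.cls a" "lam.cls b" "lam.cls c" "lam.cls d"]
    unfolding r_def by (simp add: lam.qmult_cls)
  ultimately have "is_congruence S f r" unfolding is_congruence_def by blast
  moreover have "(e \<cdot> g, g \<cdot> e) \<in> r" if "e \<in> E" "g \<in> E" for e g
  proof -
    have "lam.cls e \<in> idempotents (S // lam S f) lam.qmult" "lam.cls g \<in> idempotents (S // lam S f) lam.qmult" using that lam.idem_quotient by blast+
    from T.same_inverses_commute[OF this] show ?thesis
      using that by (simp add: r_def lam.qmult_cls)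
  qed
  ultimately have nu_r: "nu S f \<subseteq> r" by (rule nu_least)
  fix a assume "a \<in> cong_kernel S f (nu S f)"
  then have "(a, a\<^sup>0) \<in> r" using nu.kernel_iff nu_r by blast
  then have a: "a \<in> S" and "(lam.cls a, lam.cls (a\<^sup>0)) \<in> T.same_inverses"
    by (simp_all add: r_def)
  moreover have "lam.cls (a\<^sup>0) \<in> idempotents (S // lam S f) lam.qmult" using lam.idem_quotient zero_idem[OF a] by blast
  ultimately have "lam.cls a \<in> idempotents (S // lam S f) lam.qmult" by (metis T.same_inverses_idem)
  then have "(a \<cdot> a, a) \<in> lam S f" using a lam.cls_idem_iff by simp
  then show "a \<in> cong_kernel S f (lam S f)" using a lam.square_iff lam.kernel_iff by blast
qed

subsection \<open>The equivalent conditions\<close>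

text \<open>Closure under products holds because idempotents commute modulo \<open>nu\<close>. With
  closure under inverses this makes the kernel a completely regular semigroup.\<close>

lemma nu_kernel_props:
  defines "K \<equiv> cong_kernel S f (nu S f)"
  shows idem_in_nu_kernel: "e \<in> E \<Longrightarrow> e \<in> K"
    and mult_in_nu_kernel: "a \<in> K \<Longrightarrow> b \<in> K \<Longrightarrow> a \<cdot> b \<in> K"
    and inverse_in_nu_kernel: "a \<in> K \<Longrightarrow> \<iota> a \<in> K"
    and nu_kernel_in: "a \<in> K \<Longrightarrow> a \<in> S"
proof -
  interpret nu: cr_congruence S f "nu S f" by (rule cr_congruenceI[OF nu_congruence])
  note K = nu.kernel_iff[folded K_def]
  show KS: "a \<in> S" if "a \<in> K" for a using that K nu.in_carrier by blast
  show "e \<in> K" if "e \<in> E" for e using that K nu.refl by simp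
  show "\<iota> a \<in> K" if "a \<in> K" for a
  proof -
    have a: "a \<in> S" "(a, a\<^sup>0) \<in> nu S f" using that K nu.in_carrier by blast+
    have "(a \<cdot> \<iota> a, a\<^sup>0 \<cdot> \<iota> a) \<in> nu S f" using nu.mult[OF a(2) nu.refl[OF inverse_in[OF a(1)]]] .
    then have "(\<iota> a, a\<^sup>0) \<in> nu S f" using a(1) nu.sym by simp
    then show ?thesis
      unfolding K_def cong_kernel_def using inverse_in[OF a(1)] zero_idem[OF a(1)] by blast
  qed
  show "a \<cdot> b \<in> K" if ab: "a \<in> K" "b \<in> K" for a b
  proof -
    have S: "a \<in> S" "b \<in> S" using KS ab by blast+
    have 1: "(a \<cdot> b, a\<^sup>0 \<cdot> b\<^sup>0) \<in> nu S f" using nu.mult ab K by blast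
    \<comment> \<open>Commuting the two middle factors shows that
      \<open>a\<^sup>0 b\<^sup>0\<close>, and with it \<open>a b\<close>, is idempotent modulo
      \<open>nu\<close>.\<close>
    have "(a\<^sup>0 \<cdot> ((b\<^sup>0 \<cdot> a\<^sup>0) \<cdot> b\<^sup>0), a\<^sup>0 \<cdot> ((a\<^sup>0 \<cdot> b\<^sup>0) \<cdot> b\<^sup>0)) \<in> nu S f"
      using S by (intro nu.mult nu.refl nu_commute) simp_all
    then have 2: "(a\<^sup>0 \<cdot> b\<^sup>0 \<cdot> (a\<^sup>0 \<cdot> b\<^sup>0), a\<^sup>0 \<cdot> b\<^sup>0) \<in> nu S f" using S by simp
    have "(a \<cdot> b \<cdot> (a \<cdot> b), a \<cdot> b) \<in> nu S f"
      using nu.trans[OF nu.trans[OF nu.mult[OF 1 1] 2] nu.sym[OF 1]] .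
    then show ?thesis unfolding K nu.square_iff[OF closed[OF S]] .
  qed
qed

text \<open>The kernel contains the inverses of its elements, so zeros computed in it agree with
  those of \<open>S\<close>, and its relation \<open>green_H\<close> is the restriction of that of
  \<open>S\<close>.\<close>

lemma cryptic_nu_kernel_iff:
  defines "K \<equiv> cong_kernel S f (nu S f)"
  shows "is_cryptic K f \<longleftrightarrow>
    (\<forall>a\<in>K. \<forall>b\<in>K. \<forall>c\<in>K. \<forall>d\<in>K. a\<^sup>0 = b\<^sup>0 \<longrightarrow> c\<^sup>0 = d\<^sup>0 \<longrightarrow> (a \<cdot> c)\<^sup>0 = (b \<cdot> d)\<^sup>0)"
    (is "_ \<longleftrightarrow> ?rhs")
proof -
  note K = nu_kernel_props[folded K_def]
  have "is_semigroup K f" unfolding is_semigroup_def using K(2) K(4)[THEN assoc] K(4) by blast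
  then interpret K: semigroup_on K f by unfold_locales
  have "completely_regular K f"
  proof (rule K.completely_regularI)
    fix a assume "a \<in> K"
    then show "\<exists>x\<in>K. a \<cdot> x \<cdot> a = a \<and> a \<cdot> x = x \<cdot> a"
      using K(3,4) by (intro bexI[of _ "\<iota> a"]) simp_all
  qed
  then interpret K: cr_semigroup K f by unfold_locales
  have zero: "K.zero_of a = a\<^sup>0" if "a \<in> K" for a
    using K.zero_eqI[OF that K(3)[OF that]] K(4)[OF that] by simp
  have H: "(a, b) \<in> green_H K f \<longleftrightarrow> a \<in> K \<and> b \<in> K \<and> a\<^sup>0 = b\<^sup>0" for a b
    using K.green_H_iff zero by metis
  have "equiv K (green_H K f)"
    unfolding equiv_def refl_on_def sym_def trans_def by (auto simp: H)
  then have "is_cryptic K f \<longleftrightarrow> (\<forall>p\<in>green_H K f. \<forall>q\<in>green_H K f. (fst p \<cdot> fst q, snd p \<cdot> snd q) \<in> green_H K f)"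
    unfolding is_cryptic_def is_congruence_def using K.semigroup by (simp add: case_prod_beta)
  also have "\<dots> \<longleftrightarrow> ?rhs"
  proof
    assume h: "\<forall>p\<in>green_H K f. \<forall>q\<in>green_H K f. (fst p \<cdot> fst q, snd p \<cdot> snd q) \<in> green_H K f"
    show ?rhs
    proof (intro ballI impI)
      fix a b c d assume "a \<in> K" "b \<in> K" "c \<in> K" "d \<in> K" "a\<^sup>0 = b\<^sup>0" "c\<^sup>0 = d\<^sup>0"
      then show "(a \<cdot> c)\<^sup>0 = (b \<cdot> d)\<^sup>0"
        using h[THEN bspec, THEN bspec, of "(a, b)" "(c, d)"] by (simp add: H)
    qed
  next
    assume h: ?rhs
    show "\<forall>p\<in>green_H K f. \<forall>q\<in>green_H K f. (fst p \<cdot> fst q, snd p \<cdot> snd q) \<in> green_H K f"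
    proof (intro ballI)
      fix p q assume "p \<in> green_H K f" "q \<in> green_H K f"
      then have p: "fst p \<in> K" "snd p \<in> K" "(fst p)\<^sup>0 = (snd p)\<^sup>0"
        and q: "fst q \<in> K" "snd q \<in> K" "(fst q)\<^sup>0 = (snd q)\<^sup>0"
        using H by (metis prod.collapse)+
      show "(fst p \<cdot> fst q, snd p \<cdot> snd q) \<in> green_H K f"
        unfolding H using K(2)[OF p(1) q(1)] K(2)[OF p(2) q(2)] h[rule_format, OF p(1,2) q(1,2) p(3) q(3)] by blast
    qed
  qed
  finally show ?thesis .
qed

text \<open>Forward, \<open>a\<close> and \<open>a\<^sup>0\<close> are compared by
  \<open>mu_idempotentsI\<close>, whose multipliers are idempotents and so lie in the kernel of
  \<open>nu\<close>. Backward, elements of that kernel with the same zero are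
  \<open>mu\<close>-related to this zero, and \<open>mu\<close> is compatible with products.\<close>

lemma cryptic_iff_kernel:
  "is_cryptic (cong_kernel S f (nu S f)) f \<longleftrightarrow> cong_kernel S f (nu S f) \<subseteq> cong_kernel S f (mu S f)"
proof
  interpret mu: cr_congruence S f "mu S f" by (rule cr_congruenceI[OF mu_congruence])
  let ?K = "cong_kernel S f (nu S f)"
  note K = nu_kernel_props
  {
    assume h: "is_cryptic ?K f"
    have H: "(a \<cdot> c)\<^sup>0 = (b \<cdot> d)\<^sup>0" if "a \<in> ?K" "b \<in> ?K" "c \<in> ?K" "d \<in> ?K" "a\<^sup>0 = b\<^sup>0" "c\<^sup>0 = d\<^sup>0" for a b c d
      using that h[unfolded cryptic_nu_kernel_iff] by blast
    show "?K \<subseteq> cong_kernel S f (mu S f)"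
    proof
      fix a assume a: "a \<in> ?K"
      have aS: "a \<in> S" using K(4) a .
      have a0: "a\<^sup>0 \<in> ?K" "a\<^sup>0 = (a\<^sup>0)\<^sup>0" using K(1) aS by simp_all
      have r: "(a \<cdot> e)\<^sup>0 = (a\<^sup>0 \<cdot> e)\<^sup>0" if "e \<in> E" for e
        using H[OF a a0(1) K(1)[OF that] K(1)[OF that] a0(2) HOL.refl] .
      have "(a, a\<^sup>0) \<in> mu S f"
      proof (rule mu_idempotentsI[OF aS _ a0(2)])
        show "(e \<cdot> a)\<^sup>0 = (e \<cdot> a\<^sup>0)\<^sup>0" if "e \<in> E" for e
          using H[OF K(1)[OF that] K(1)[OF that] a a0(1) HOL.refl a0(2)] .
        show "(e \<cdot> (a \<cdot> g))\<^sup>0 = (e \<cdot> (a\<^sup>0 \<cdot> g))\<^sup>0" if "e \<in> E" "g \<in> E" for e g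
          using H[OF K(1)[OF that(1)] K(1)[OF that(1)] K(2)[OF a K(1)[OF that(2)]]
              K(2)[OF a0(1) K(1)[OF that(2)]] HOL.refl r[OF that(2)]] .
      qed (use aS r in simp_all)
      then show "a \<in> cong_kernel S f (mu S f)" using mu.kernel_iff by blast
    qed
  next
    assume h: "?K \<subseteq> cong_kernel S f (mu S f)"
    have mu: "(a, b) \<in> mu S f" if "a \<in> ?K" "b \<in> ?K" "a\<^sup>0 = b\<^sup>0" for a b
    proof -
      have "(a, a\<^sup>0) \<in> mu S f" "(b, a\<^sup>0) \<in> mu S f"
        using that h mu.kernel_iff by auto
      then show ?thesis using mu.trans mu.sym by blast
    qed
    show "is_cryptic ?K f"
      unfolding cryptic_nu_kernel_iff using mu mu_zero[OF mu.mult] by blast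
  }
qed

lemma nu_Int_green_H_equivalences:
  shows kernel_iff_nu_Int_mu: "cong_kernel S f (nu S f) \<subseteq> cong_kernel S f (mu S f) \<longleftrightarrow>
      nu S f \<inter> green_H S f = nu S f \<inter> mu S f"
    and nu_Int_mu_iff_congruence: "nu S f \<inter> green_H S f = nu S f \<inter> mu S f \<longleftrightarrow>
      is_congruence S f (nu S f \<inter> green_H S f)"
proof -
  interpret mu: cr_congruence S f "mu S f" by (rule cr_congruenceI[OF mu_congruence])
  interpret nu: cr_congruence S f "nu S f" by (rule cr_congruenceI[OF nu_congruence])
  have mu_H: "mu S f \<subseteq> green_H S f"
    using green_H_iff mu_zero mu.in_carrier by auto
  show "nu S f \<inter> green_H S f = nu S f \<inter> mu S f \<longleftrightarrow> is_congruence S f (nu S f \<inter> green_H S f)"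
  proof
    assume h: "is_congruence S f (nu S f \<inter> green_H S f)"
    have "idempotent_separating S f (nu S f \<inter> green_H S f)"
      by (simp add: idempotent_separating_def green_H_iff)
    then have "nu S f \<inter> green_H S f \<subseteq> mu S f" using mu_greatest[OF h] by blast
    then show "nu S f \<inter> green_H S f = nu S f \<inter> mu S f" using mu_H by blast
  qed (simp add: is_congruence_Int nu_congruence mu_congruence)
  show "cong_kernel S f (nu S f) \<subseteq> cong_kernel S f (mu S f) \<longleftrightarrow>
      nu S f \<inter> green_H S f = nu S f \<inter> mu S f"
  proof
    assume h: "nu S f \<inter> green_H S f = nu S f \<inter> mu S f"
    show "cong_kernel S f (nu S f) \<subseteq> cong_kernel S f (mu S f)"
    proof
      fix a assume "a \<in> cong_kernel S f (nu S f)"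
      then have a: "(a, a\<^sup>0) \<in> nu S f" using nu.kernel_iff by blast
      then have "(a, a\<^sup>0) \<in> green_H S f" using nu.in_carrier[OF a] by (simp add: green_H_iff)
      then show "a \<in> cong_kernel S f (mu S f)" using a h mu.kernel_iff by blast
    qed
  next
    assume h: "cong_kernel S f (nu S f) \<subseteq> cong_kernel S f (mu S f)"
    have "(a, b) \<in> mu S f" if nu: "(a, b) \<in> nu S f" and H: "(a, b) \<in> green_H S f" for a b
    proof -
      have S: "a \<in> S" "b \<in> S" and z: "b\<^sup>0 = a\<^sup>0" using H by (simp_all add: green_H_iff)
      \<comment> \<open>The quotient \<open>a \<iota> b\<close> carries the comparison of
        \<open>a\<close> and \<open>b\<close> into the kernel of \<open>nu\<close>; multiplying by
        \<open>b\<close> at the end brings it back.\<close>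
      have "(a \<cdot> \<iota> b, b \<cdot> \<iota> b) \<in> nu S f" using nu.mult[OF nu nu.refl[OF inverse_in[OF S(2)]]] .
      then have "a \<cdot> \<iota> b \<in> cong_kernel S f (nu S f)"
        unfolding cong_kernel_def inverse_right
        using closed[OF S(1) inverse_in[OF S(2)]] zero_idem[OF S(2)] by blast
      then have "(a \<cdot> \<iota> b, (a \<cdot> \<iota> b)\<^sup>0) \<in> mu S f" using h mu.kernel_iff by blast
      moreover have "(a \<cdot> \<iota> b)\<^sup>0 = b\<^sup>0"
      proof -
        \<comment> \<open>Since \<open>a\<close> and \<open>b\<close> share their zero,
          \<open>b \<iota> a\<close> is the commuting inverse of \<open>a \<iota> b\<close>.\<close>
        have 1: "a \<cdot> \<iota> b \<cdot> (b \<cdot> \<iota> a) = a\<^sup>0" "b \<cdot> \<iota> a \<cdot> (a \<cdot> \<iota> b) = a\<^sup>0"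
          using S by (simp_all add: z) (simp_all flip: z)
        then have "(a \<cdot> \<iota> b)\<^sup>0 = a \<cdot> \<iota> b \<cdot> (b \<cdot> \<iota> a)"
          using S by (intro zero_eqI) (simp_all add: z)
        then show ?thesis using 1 z by simp
      qed
      ultimately have "(a \<cdot> \<iota> b \<cdot> b, b\<^sup>0 \<cdot> b) \<in> mu S f"
        using mu.mult[OF _ mu.refl[OF S(2)]] by simp
      then show ?thesis using S zero_right[OF S(1)] by (simp add: z) (simp flip: z)
    qed
    then show "nu S f \<inter> green_H S f = nu S f \<inter> mu S f" using mu_H by auto
  qed
qed

section \<open>Conditions on the least orthodox congruence\<close>

lemma kernel_iff_lam_subset_mu:
  "cong_kernel S f (nu S f) \<subseteq> cong_kernel S f (mu S f) \<longleftrightarrow> lam S f \<subseteq> mu S f"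
proof
  interpret nu: cr_congruence S f "nu S f" by (rule cr_congruenceI[OF nu_congruence])
  interpret mu: cr_congruence S f "mu S f" by (rule cr_congruenceI[OF mu_congruence])
  have Int: "is_congruence S f (nu S f \<inter> mu S f)"
    by (rule is_congruence_Int[OF nu_congruence mu_congruence])
  assume h: "cong_kernel S f (nu S f) \<subseteq> cong_kernel S f (mu S f)"
  \<comment> \<open>Products of idempotents lie in the kernel of \<open>nu\<close>, hence in that of
    \<open>mu\<close>; so \<open>nu \<inter> mu\<close> is itself an orthodox congruence.\<close>
  have "(e \<cdot> g, (e \<cdot> g)\<^sup>0) \<in> nu S f \<inter> mu S f" if "e \<in> E" "g \<in> E" for e g
    using that idem_in_nu_kernel mult_in_nu_kernel[of e g] h nu.kernel_iff mu.kernel_iff by blast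
  then have "orthodox_congruence S f (nu S f \<inter> mu S f)"
    unfolding cr_congruence.orthodox_congruence_iff[OF cr_congruenceI[OF Int]] by blast
  then show "lam S f \<subseteq> mu S f" using lam_least by blast
next
  assume "lam S f \<subseteq> mu S f"
  then have "cong_kernel S f (lam S f) \<subseteq> cong_kernel S f (mu S f)"
    unfolding cong_kernel_def by blast
  then show "cong_kernel S f (nu S f) \<subseteq> cong_kernel S f (mu S f)"
    using kernel_nu_subset_kernel_lam by blast
qed

text \<open>The least congruence \<open>l\<close> containing the trace of \<open>r\<close> lies
  inside \<open>r\<close>, so its trace is exactly that of \<open>r\<close>. It is the identity iff
  this trace is.\<close>

lemma least_same_trace_iff:
  assumes "is_congruence S f r"
  shows "least_same_trace S f r = Id_on S \<longleftrightarrow> idempotent_separating S f r"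
proof -
  interpret r: congruence_on S f r by unfold_locales fact
  let ?Q = "\<lambda>t. is_congruence S f t \<and> cong_trace S f r \<subseteq> t"
  define l where "l = (LEAST t. ?Q t)"
  have "cong_trace S f r \<subseteq> S \<times> S" unfolding cong_trace_def using r.in_carrier by auto
  note l = Least_congruence[OF this, of ?Q, OF HOL.refl, folded l_def]
  have "l \<subseteq> r" using l(3)[OF assms] unfolding cong_trace_def by blast
  then have "cong_trace S f l = cong_trace S f r" using l(2) unfolding cong_trace_def by blast
  then have "least_same_trace S f r = l"
    unfolding least_same_trace_def using l by (intro Least_equality) (auto simp: cong_trace_def)
  moreover have "l = Id_on S \<longleftrightarrow> idempotent_separating S f r"
  proof
    assume "l = Id_on S"
    then show "idempotent_separating S f r"
      using l(2) unfolding idempotent_separating_def cong_trace_def by blast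
  next
    assume "idempotent_separating S f r"
    then have "cong_trace S f r \<subseteq> Id_on S"
      unfolding idempotent_separating_def cong_trace_def using idem_in by fast
    then have "l \<subseteq> Id_on S" by (rule l(3)[OF is_congruence_Id_on])
    moreover have "Id_on S \<subseteq> l"
      using l(1) unfolding is_congruence_def equiv_def refl_on_def by blast
    ultimately show "l = Id_on S" by blast
  qed
  ultimately show ?thesis by simp
qed

text \<open>Any two idempotents are \<open>Theta\<close>-related. Conversely, if
  \<open>a\<^sup>0 = b\<^sup>0\<close>, the defining equation of \<open>Theta\<close> reads
  \<open>b = a\<close>.\<close>

lemma Int_Theta_iff:
  assumes "is_congruence S f r"
  shows "r \<inter> Theta S f = Id_on S \<longleftrightarrow> idempotent_separating S f r"
proof
  interpret r: cr_congruence S f r using assms by (rule cr_congruenceI)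
  {
    assume h: "r \<inter> Theta S f = Id_on S"
    show "idempotent_separating S f r"
      unfolding idempotent_separating_def
    proof (intro ballI impI)
      fix e g assume "e \<in> E" "g \<in> E" "(e, g) \<in> r"
      then have "(e, g) \<in> r \<inter> Theta S f" by (simp add: Theta_def)
      then show "e = g" unfolding h by blast
    qed
  next
    assume h: "idempotent_separating S f r"
    have "a = b" if r: "(a, b) \<in> r" and T: "(a, b) \<in> Theta S f" for a b
    proof -
      have "a \<in> S" "b \<in> S" "a\<^sup>0 \<cdot> b = a \<cdot> b\<^sup>0" using T by (simp_all add: Theta_def)
      moreover have "a\<^sup>0 = b\<^sup>0"
        using mu_greatest[OF assms] h r mu_zero[of a b] by blast
      ultimately show ?thesis by (metis zero_left zero_right)
    qed
    moreover have "(a, a) \<in> r \<inter> Theta S f" if "a \<in> S" for a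
      using that r.refl by (simp add: Theta_def)
    ultimately show "r \<inter> Theta S f = Id_on S" using r.in_carrier(1) by fast
  }
qed

text \<open>The class of an idempotent is a subsemigroup, and a group has only one idempotent.
  Conversely, all elements of a class share one zero, which is the identity of the class when it is
  a subsemigroup.\<close>

lemma over_groups_iff:
  assumes "is_congruence S f r"
  shows "over_groups S f r \<longleftrightarrow> idempotent_separating S f r"
proof
  interpret r: cr_congruence S f r using assms by (rule cr_congruenceI)
  {
    assume h: "over_groups S f r"
    show "idempotent_separating S f r"
      unfolding idempotent_separating_def
    proof (intro ballI impI)
      fix e g assume e: "e \<in> E" and g: "g \<in> E" and eg: "(e, g) \<in> r"
      have "x \<cdot> y \<in> r.cls e" if "x \<in> r.cls e" "y \<in> r.cls e" for x y
        using that r.mult[of e x e y] e by simp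
      then have "is_subgroup S f (r.cls e)"
        using h r.cls_in[OF idem_in[OF e]] unfolding over_groups_def by blast
      then have "group (as_group f (r.cls e))" by (simp add: is_subgroup_def)
      then obtain u where u: "\<And>x. x \<in> r.cls e \<Longrightarrow> x \<cdot> u = x"
          and inv: "\<And>x. x \<in> r.cls e \<Longrightarrow> \<exists>y\<in>r.cls e. x \<cdot> y = u"
        by (elim group_as_groupD) metis
      have unit: "x = u" if x: "x \<in> r.cls e" "x \<in> E" for x
      proof -
        obtain y where y: "y \<in> r.cls e" "x \<cdot> y = u" using inv x by blast
        have "y \<in> S" using y(1) r.in_carrier by blast
        then have "x \<cdot> (x \<cdot> y) = x \<cdot> y" using x(2) by simp
        then show ?thesis unfolding y(2) using u[OF x(1)] by simp
      qed
      have "e \<in> r.cls e" "g \<in> r.cls e" using eg r.refl e by simp_all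
      then show "e = g" using unit e g by metis
    qed
  next
    assume "idempotent_separating S f r"
    then have zero: "a\<^sup>0 = b\<^sup>0" if "(a, b) \<in> r" for a b
      using mu_greatest[OF assms] mu_zero[of a b] that by blast
    show "over_groups S f r"
      unfolding over_groups_def
    proof (intro ballI impI)
      fix A assume "A \<in> S // r" and closed_A: "\<forall>a\<in>A. \<forall>b\<in>A. a \<cdot> b \<in> A"
      then obtain a where a: "a \<in> S" and A: "A = r.cls a" by (elim quotientE)
      have "a \<in> A" using A r.refl[OF a] by simp
      \<comment> \<open>The class contains both \<open>a\<close> and \<open>a a\<close>, which puts
        \<open>a\<^sup>0\<close> into it.\<close>
      then have "(a, a \<cdot> a) \<in> r" using closed_A unfolding A by blast
      then have a0: "(a, a\<^sup>0) \<in> r" using r.square_iff[OF a] r.sym by blast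
      have xS: "x \<in> S" and x0: "x\<^sup>0 = a\<^sup>0" if "x \<in> A" for x
        using that zero[of x a, OF r.sym] r.in_carrier(2)[of a x] unfolding A by blast+
      have "group (as_group f A)"
      proof (rule group_as_groupI)
        show "a\<^sup>0 \<in> A" using a0 A by simp
      next
        fix x assume x: "x \<in> A"
        show "a\<^sup>0 \<cdot> x = x" "x \<cdot> a\<^sup>0 = x"
          using zero_left[OF xS[OF x]] zero_right[OF xS[OF x]] unfolding x0[OF x] by simp_all
        \<comment> \<open>Multiplying by \<open>\<iota> x\<close> turns this into a relation between
          \<open>a\<^sup>0\<close> and \<open>\<iota> x\<close>, so the class is closed under
          inverses.\<close>
        have "(x, a\<^sup>0) \<in> r" using x a0 r.sym r.trans unfolding A by blast
        then have "(x \<cdot> \<iota> x, a\<^sup>0 \<cdot> \<iota> x) \<in> r" using r.mult[OF _ r.refl[OF inverse_in[OF xS[OF x]]]] by blast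
        then have "(a\<^sup>0, \<iota> x) \<in> r"
          using xS[OF x] zero_inverse[OF xS[OF x]] unfolding x0[OF x] inverse_right by simp
        then have "\<iota> x \<in> A" using a0 r.trans unfolding A by blast
        then show "\<exists>y\<in>A. y \<cdot> x = a\<^sup>0" using inverse_left[OF xS[OF x]] x0[OF x] by metis
      qed (use closed_A xS in \<open>simp_all\<close>)
      then show "is_subgroup S f A" using xS unfolding is_subgroup_def by blast
    qed
  }
qed

end

theorem theorem2p9:
  fixes S :: "'a set" and f :: "'a \<Rightarrow> 'a \<Rightarrow> 'a"
  assumes "completely_regular S f"
  shows
    "(is_cryptic (cong_kernel S f (nu S f)) f \<longleftrightarrow> cong_kernel S f (nu S f) \<subseteq> cong_kernel S f (mu S f)) \<and>
     (is_cryptic (cong_kernel S f (nu S f)) f \<longleftrightarrow> nu S f \<inter> green_H S f = nu S f \<inter> mu S f) \<and>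
     (is_cryptic (cong_kernel S f (nu S f)) f \<longleftrightarrow> is_congruence S f (nu S f \<inter> green_H S f)) \<and>
     (is_cryptic (cong_kernel S f (nu S f)) f \<longleftrightarrow> lam S f \<subseteq> mu S f) \<and>
     (is_cryptic (cong_kernel S f (nu S f)) f \<longleftrightarrow> least_same_trace S f (lam S f) = Id_on S) \<and>
     (is_cryptic (cong_kernel S f (nu S f)) f \<longleftrightarrow> (\<exists>r. orthodox_congruence S f r \<and> idempotent_separating S f r)) \<and>
     (is_cryptic (cong_kernel S f (nu S f)) f \<longleftrightarrow> lam S f \<inter> Theta S f = Id_on S) \<and>
     (is_cryptic (cong_kernel S f (nu S f)) f \<longleftrightarrow> over_groups S f (lam S f))"
proof -
  interpret cr_semigroup S f by unfold_locales (rule assms)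
  have "lam S f \<subseteq> mu S f \<longleftrightarrow> idempotent_separating S f (lam S f)"
    using mu_greatest[OF lam_congruence] by simp
  \<comment> \<open>Any witness \<open>r\<close> contains \<open>lam\<close>, and idempotent
    separation passes to smaller relations.\<close>
  moreover have "(\<exists>r. orthodox_congruence S f r \<and> idempotent_separating S f r) \<longleftrightarrow>
      idempotent_separating S f (lam S f)"
    using lam_orthodox lam_least unfolding idempotent_separating_def by blast
  ultimately show ?thesis
    unfolding cryptic_iff_kernel nu_Int_mu_iff_congruence[symmetric] kernel_iff_nu_Int_mu[symmetric]
      kernel_iff_lam_subset_mu least_same_trace_iff[OF lam_congruence] Int_Theta_iff[OF lam_congruence]
      over_groups_iff[OF lam_congruence]
    by simp
qed

end
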